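(* Let $a,b,\beta>0$, $r\ge 0$ and $\alpha=\tfrac b2+r$. Consider the quasi-static slider-pusher system with frictionless contact, with state $\mathbf{x}=(x_s,y_s,\theta_s,c,x_p,y_p,\theta_p)$ and input $\mathbf{u}=(v_t,v_n,v_p,\omega_p)$, governed by $$\dot x_s=-\frac{\beta^2}{\beta^2+c^2}v_n\sin\theta_s,\quad \dot y_s=\frac{\beta^2}{\beta^2+c^2}v_n\cos\theta_s,\quad \dot\theta_s=\frac{c}{\beta^2+c^2}v_n,\quad \dot c=v_t-\alpha\frac{c}{\beta^2+c^2}v_n,$$ $$x_p=x_s+c\cos\theta_s+\alpha\sin\theta_s,\qquad y_p=y_s+c\sin\theta_s-\alpha\cos\theta_s,$$ $$\dot x_p=-v_p\sin\theta_p,\qquad \dot y_p=v_p\cos\theta_p,\qquad \dot\theta_p=\omega_p.$$ This system is differentially flat with flat coordinates $$\boldsymbol{\zeta}=\begin{pmatrix}x_s\\ y_s\end{pmatrix}.$$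
   Context: Slider and pusher. $(x_s,y_s)$ and $\theta_s$ are the planar position and orientation, in a global frame, of a rectangular slider of width $a$ and length $b$. The number $c$ is the position of the contact point relative to the slider's width symmetry axis, and $v_t,v_n$ are the tangential and normal velocity of the pusher expressed in the slider's frame. Contact is assumed to be maintained. The pusher has radius $r$ and is a kinematic car with planar pose $(x_p,y_p,\theta_p)$, forward velocity $v_p$ and angular velocity $\omega_p$. The constant $\beta$ is a geometric factor determined by the slider's shape and pressure distribution. Differential flatness. A system with state $\mathbf{x}\in\mathcal X\subset\mathbb{R}^{n_x}$ and input $\mathbf{u}\in\mathcal U\subset\mathbb{R}^{n_u}$ is differentially flat if there exist a variable $\boldsymbol\zeta\in\mathcal Z\subset\mathbb{R}^{n_\zeta}$, whose components are differentially independent (not related to one another by any differential equation), and smooth function operators $\Lambda,\Phi,\Psi$ such that $$\boldsymbol{\zeta}=\Lambda(\mathbf{x},\mathbf{u},\dot{\mathbf{u}},\dots,\mathbf{u}^{(\lambda)}),\qquad \mathbf{x}=\Phi(\boldsymbol\zeta,\dot{\boldsymbol\zeta},\dots,\boldsymbol\zeta^{(\phi)}),\qquad \mathbf{u}=\Psi(\boldsymbol\zeta,\dot{\boldsymbol\zeta},\dots,\boldsymbol\zeta^{(\phi+1)}),$$ where $\lambda$ and $\phi$ are the maximum orders of the derivatives needed. The components of $\boldsymbol\zeta$ are then called the flat coordinates.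
   Formalization: The state and input sets are restricted: v_n and v_p are nonzero with fixed signs (any choice), and θ_s and θ_p each lie in an open interval of length 2π (any centre); without this, e.g. when v_n = 0, the state is not determined by (x_s, y_s). *)

theory Defs
  imports "HOL-Analysis.Analysis"
begin

definition nth_vderiv :: "nat \<Rightarrow> (real \<Rightarrow> 'a::real_normed_vector) \<Rightarrow> real \<Rightarrow> 'a" where
  "nth_vderiv k f = ((\<lambda>g t. vector_derivative g (at t)) ^^ k) f"

definition smooth_curve_on :: "real set \<Rightarrow> (real \<Rightarrow> 'a::real_normed_vector) \<Rightarrow> bool" where
  "smooth_curve_on I f \<longleftrightarrow> (\<forall>k. \<forall>t\<in>I. nth_vderiv k f differentiable (at t))"

text \<open>
  The number of derivatives entering an operator is not bounded in advance, so operators act on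
  infinite jets \<open>j :: nat \<Rightarrow> 'a\<close>, where \<open>j k\<close> stands for the \<open>k\<close>-th derivative, and an
  operator of order at most \<open>m\<close> is one that only looks at \<open>j 0, \<dots>, j m\<close>.  Jets carry the product
  topology, so for an operator of finite order continuity and smoothness below are the usual
  ones in finitely many real variables: all iterated partial derivatives exist and are continuous.
\<close>

definition jet :: "(real \<Rightarrow> 'a::real_normed_vector) \<Rightarrow> real \<Rightarrow> nat \<Rightarrow> 'a" where
  "jet f t = (\<lambda>k. nth_vderiv k f t)"

definition jet_line :: "nat \<Rightarrow> 'a::real_vector \<Rightarrow> (nat \<Rightarrow> 'a) \<Rightarrow> real \<Rightarrow> nat \<Rightarrow> 'a" where
  "jet_line i e j s = j(i := j i + s *\<^sub>R e)"

definition jet_partial ::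
    "nat \<Rightarrow> 'a::real_vector \<Rightarrow> ((nat \<Rightarrow> 'a) \<Rightarrow> 'b::real_normed_vector) \<Rightarrow> (nat \<Rightarrow> 'a) \<Rightarrow> 'b" where
  "jet_partial i e F j = vector_derivative (\<lambda>s. F (jet_line i e j s)) (at 0)"

primrec jet_C ::
    "nat \<Rightarrow> (nat \<Rightarrow> 'a::euclidean_space) set \<Rightarrow> ((nat \<Rightarrow> 'a) \<Rightarrow> 'b::real_normed_vector) \<Rightarrow> bool" where
  "jet_C 0 D F \<longleftrightarrow> continuous_on D F"
| "jet_C (Suc n) D F \<longleftrightarrow> continuous_on D F \<and>
     (\<forall>i. \<forall>e\<in>Basis. (\<forall>j\<in>D. (\<lambda>s. F (jet_line i e j s)) differentiable (at 0)) \<and>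
                    jet_C n D (jet_partial i e F))"

definition jet_smooth_on ::
    "(nat \<Rightarrow> 'a::euclidean_space) set \<Rightarrow> ((nat \<Rightarrow> 'a) \<Rightarrow> 'b::real_normed_vector) \<Rightarrow> bool" where
  "jet_smooth_on D F \<longleftrightarrow> open D \<and> (\<forall>n. jet_C n D F)"

definition jet_order_le :: "nat \<Rightarrow> ((nat \<Rightarrow> 'a) \<Rightarrow> 'b) \<Rightarrow> bool" where
  "jet_order_le m F \<longleftrightarrow> (\<forall>j j'. (\<forall>i\<le>m. j i = j' i) \<longrightarrow> F j = F j')"

text \<open>
  A differential relation on a set \<open>J\<close> of jets is an equation \<open>F (\<zeta>, \<zeta>', \<dots>, \<zeta>\<^sup>(\<^sup>m\<^sup>)) = 0\<close>, given on an
  open region \<open>W\<close> which meets \<open>J\<close>, that every jet of \<open>J\<close> in the region satisfies.  It has to be a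
  genuine equation, i.e. it must not degenerate to \<open>0 = 0\<close> on an open set.
\<close>

definition differential_relation ::
    "(nat \<Rightarrow> 'z::euclidean_space) set \<Rightarrow> nat \<Rightarrow> (nat \<Rightarrow> 'z) set \<Rightarrow> ((nat \<Rightarrow> 'z) \<Rightarrow> real) \<Rightarrow> bool" where
  "differential_relation J m W F \<longleftrightarrow>
     jet_smooth_on W F \<and> jet_order_le m F \<and> interior {j \<in> W. F j = 0} = {} \<and>
     W \<inter> J \<noteq> {} \<and> (\<forall>j \<in> W \<inter> J. F j = 0)"

definition differentially_independent :: "(nat \<Rightarrow> 'z::euclidean_space) set \<Rightarrow> bool" where
  "differentially_independent J \<longleftrightarrow> J \<noteq> {} \<and> (\<nexists>m W F. differential_relation J m W F)"

text \<open>
  A system is a relation \<open>S x x' u\<close> between state, time derivative of the state, and input; this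
  covers differential equations together with algebraic constraints.
\<close>

definition trajectory ::
    "('x::real_normed_vector \<Rightarrow> 'x \<Rightarrow> 'u::real_normed_vector \<Rightarrow> bool) \<Rightarrow> 'x set \<Rightarrow> 'u set \<Rightarrow>
     real set \<Rightarrow> (real \<Rightarrow> 'x) \<Rightarrow> (real \<Rightarrow> 'u) \<Rightarrow> bool" where
  "trajectory S X U I x u \<longleftrightarrow>
     open I \<and> is_interval I \<and> smooth_curve_on I x \<and> smooth_curve_on I u \<and>
     (\<forall>t\<in>I. x t \<in> X \<and> u t \<in> U \<and> S (x t) (vector_derivative x (at t)) (u t))"

definition output_curve ::
    "('x \<Rightarrow> (nat \<Rightarrow> 'u::real_normed_vector) \<Rightarrow> 'z) \<Rightarrow> (real \<Rightarrow> 'x) \<Rightarrow> (real \<Rightarrow> 'u) \<Rightarrow> real \<Rightarrow> 'z" where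
  "output_curve \<Lambda> x u = (\<lambda>t. \<Lambda> (x t) (jet u t))"

definition output_jets ::
    "('x::real_normed_vector \<Rightarrow> 'x \<Rightarrow> 'u::real_normed_vector \<Rightarrow> bool) \<Rightarrow> 'x set \<Rightarrow> 'u set \<Rightarrow>
     ('x \<Rightarrow> (nat \<Rightarrow> 'u) \<Rightarrow> 'z::real_normed_vector) \<Rightarrow> (nat \<Rightarrow> 'z) set" where
  "output_jets S X U \<Lambda> =
     {jet (output_curve \<Lambda> x u) t | I x u t. trajectory S X U I x u \<and> t \<in> I}"

text \<open>
  \<open>\<Lambda>\<close> takes the state and the jet of the input.  To speak about its joint smoothness it is read
  as an operator on jets of the pair of state and input that ignores the derivatives of the state.
\<close>

definition differentially_flat ::
    "('x::euclidean_space \<Rightarrow> 'x \<Rightarrow> 'u::euclidean_space \<Rightarrow> bool) \<Rightarrow> 'x set \<Rightarrow> 'u set \<Rightarrow>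
     ('x \<Rightarrow> (nat \<Rightarrow> 'u) \<Rightarrow> 'z::euclidean_space) \<Rightarrow> bool" where
  "differentially_flat S X U \<Lambda> \<longleftrightarrow>
     differentially_independent (output_jets S X U \<Lambda>) \<and>
     (\<exists>l D. (\<forall>x. jet_order_le l (\<Lambda> x)) \<and>
        jet_smooth_on D (\<lambda>j. \<Lambda> (fst (j 0)) (\<lambda>k. snd (j k))) \<and>
        (\<forall>I x u. trajectory S X U I x u \<longrightarrow> (\<forall>t\<in>I. jet (\<lambda>\<tau>. (x \<tau>, u \<tau>)) t \<in> D))) \<and>
     (\<exists>m D \<Phi> \<Psi>. jet_order_le m \<Phi> \<and> jet_order_le (m + 1) \<Psi> \<and>
        jet_smooth_on D \<Phi> \<and> jet_smooth_on D \<Psi> \<and>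
        output_jets S X U \<Lambda> \<subseteq> D \<and>
        (\<forall>I x u. trajectory S X U I x u \<longrightarrow>
           (\<forall>t\<in>I. x t = \<Phi> (jet (output_curve \<Lambda> x u) t) \<and>
                  u t = \<Psi> (jet (output_curve \<Lambda> x u) t))))"

type_synonym sp_state = "real \<times> real \<times> real \<times> real \<times> real \<times> real \<times> real"
type_synonym sp_input = "real \<times> real \<times> real \<times> real"

fun slider_pusher :: "real \<Rightarrow> real \<Rightarrow> sp_state \<Rightarrow> sp_state \<Rightarrow> sp_input \<Rightarrow> bool" where
  "slider_pusher \<alpha> \<beta> (x\<^sub>s, y\<^sub>s, \<theta>\<^sub>s, c, x\<^sub>p, y\<^sub>p, \<theta>\<^sub>p) (x\<^sub>s', y\<^sub>s', \<theta>\<^sub>s', c', x\<^sub>p', y\<^sub>p', \<theta>\<^sub>p') (v\<^sub>t, v\<^sub>n, v\<^sub>p, \<omega>\<^sub>p) \<longleftrightarrow>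
     x\<^sub>s' = - (\<beta>\<^sup>2 / (\<beta>\<^sup>2 + c\<^sup>2)) * v\<^sub>n * sin \<theta>\<^sub>s \<and>
     y\<^sub>s' = \<beta>\<^sup>2 / (\<beta>\<^sup>2 + c\<^sup>2) * v\<^sub>n * cos \<theta>\<^sub>s \<and>
     \<theta>\<^sub>s' = c / (\<beta>\<^sup>2 + c\<^sup>2) * v\<^sub>n \<and>
     c' = v\<^sub>t - \<alpha> * (c / (\<beta>\<^sup>2 + c\<^sup>2)) * v\<^sub>n \<and>
     x\<^sub>p = x\<^sub>s + c * cos \<theta>\<^sub>s + \<alpha> * sin \<theta>\<^sub>s \<and>
     y\<^sub>p = y\<^sub>s + c * sin \<theta>\<^sub>s - \<alpha> * cos \<theta>\<^sub>s \<and>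
     x\<^sub>p' = - v\<^sub>p * sin \<theta>\<^sub>p \<and>
     y\<^sub>p' = v\<^sub>p * cos \<theta>\<^sub>p \<and>
     \<theta>\<^sub>p' = \<omega>\<^sub>p"

text \<open>
  The state and input sets.  While \<open>v\<^sub>n = 0\<close> the slider is at rest and its position carries no
  information about the rest of the state, so \<open>v\<^sub>n \<noteq> 0\<close> is needed; the system equations give
  \<open>v\<^sub>p\<^sup>2 = v\<^sub>t\<^sup>2 + v\<^sub>n\<^sup>2\<close>, hence also \<open>v\<^sub>p \<noteq> 0\<close>.  The system is invariant under shifting either
  angle by \<open>2 * pi\<close>, and (with \<open>\<theta>\<^sub>p\<close> shifted by \<open>pi\<close>) under reversing the sign of \<open>v\<^sub>p\<close>, and a
  given curve \<open>(x\<^sub>s, y\<^sub>s)\<close> can be produced with either sign of \<open>v\<^sub>n\<close>; so the state is determined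
  only after a branch of the angles and the signs of \<open>v\<^sub>n\<close> and \<open>v\<^sub>p\<close> are chosen.  The branch centres
  \<open>\<mu>\<^sub>s\<close>, \<open>\<mu>\<^sub>p\<close> and the signs \<open>\<sigma>\<^sub>n\<close>, \<open>\<sigma>\<^sub>p\<close> are parameters; together the choices cover all
  trajectories with \<open>v\<^sub>n \<noteq> 0\<close> locally in time.
\<close>

definition sp_states :: "real \<Rightarrow> real \<Rightarrow> sp_state set" where
  "sp_states \<mu>\<^sub>s \<mu>\<^sub>p = {(x\<^sub>s, y\<^sub>s, \<theta>\<^sub>s, c, x\<^sub>p, y\<^sub>p, \<theta>\<^sub>p). \<bar>\<theta>\<^sub>s - \<mu>\<^sub>s\<bar> < pi \<and> \<bar>\<theta>\<^sub>p - \<mu>\<^sub>p\<bar> < pi}"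

definition sp_inputs :: "real \<Rightarrow> real \<Rightarrow> sp_input set" where
  "sp_inputs \<sigma>\<^sub>n \<sigma>\<^sub>p = {(v\<^sub>t, v\<^sub>n, v\<^sub>p, \<omega>\<^sub>p). \<sigma>\<^sub>n * v\<^sub>n > 0 \<and> \<sigma>\<^sub>p * v\<^sub>p > 0}"

end

theory Submission
  imports Defs
begin

text \<open>
  The velocity of the slider has direction \<open>(- sin \<theta>\<^sub>s, cos \<theta>\<^sub>s)\<close>, so \<open>\<theta>\<^sub>s\<close> is read off it, and
  \<open>c = \<beta>\<^sup>2 \<theta>\<^sub>s' / w\<close> with \<open>w\<close> the signed speed.  Then \<open>v\<^sub>n\<close>, \<open>v\<^sub>t\<close> and the position of the pusher
  follow, and the velocity of the pusher gives \<open>v\<^sub>p\<close>, \<open>\<theta>\<^sub>p\<close> and \<open>\<omega>\<^sub>p\<close> in the same way.  Conversely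
  these formulas turn every smooth curve whose jets lie in the open domain of the formulas into a
  trajectory.  Taylor polynomials realise all finite parts of the jets near a given one, hence a
  differential relation would vanish on an open set.
\<close>

section \<open>Smooth curves\<close>

text \<open>The obstacle is that three of the formulas contain time derivatives of earlier ones:
  \<open>c\<close> needs that of the slider angle, the tangential velocity that of \<open>c\<close>,
  the turning rate of the pusher that of its heading. Each has to be a smooth operator on jets of
  finite order, and explicit formulas grow quickly. So these derivatives are never computed: a
  syntactic class of operators is closed under differentiation along curves, and uniqueness of
  derivatives identifies the chosen operator with the actual derivative on a trajectory. Each
  differentiation costs one order: the slider angle has order 1, \<open>c\<close> order 2, the
  tangential velocity and the pusher heading order 3, the turning rate order 4. Hence the state
  needs order 3 and the input order 4. The domain is given by two strict inequalities, one for each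
  heading. They encode both the chosen branch and the chosen sign, so the same open set serves for
  recovering trajectories and for constructing them.\<close>

lemma nth_vderiv_0 [simp]: "nth_vderiv 0 f = f"
  by (simp add: nth_vderiv_def)

lemma nth_vderiv_Suc: "nth_vderiv (Suc k) f t = vector_derivative (nth_vderiv k f) (at t)"
  by (simp add: nth_vderiv_def)

lemma jet_0 [simp]: "jet f t 0 = f t"
  by (simp add: jet_def)

lemma smooth_curve_on_nth_vderiv:
  assumes "smooth_curve_on I f" "t \<in> I"
  shows "(nth_vderiv k f has_vector_derivative nth_vderiv (Suc k) f t) (at t)"
  using assms by (simp add: smooth_curve_on_def nth_vderiv_Suc vector_derivative_works)

text \<open>Smoothness is shown below by exhibiting a whole tower \<open>g\<close> of derivatives.
  Agreement of \<open>f\<close> with \<open>g 0\<close> passes to derivatives because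
  \<open>I\<close> is open.\<close>

lemma nth_vderiv_eqI:
  assumes "open I" and "\<And>t. t \<in> I \<Longrightarrow> g 0 t = f t"
    and "\<And>k t. t \<in> I \<Longrightarrow> (g k has_vector_derivative g (Suc k) t) (at t)"
    and "t \<in> I"
  shows "nth_vderiv k f t = g k t"
  using \<open>t \<in> I\<close>
proof (induction k arbitrary: t)
  case 0
  then show ?case using assms(2) by simp
next
  case (Suc k)
  have "(nth_vderiv k f has_vector_derivative g (Suc k) t) (at t)"
    by (rule has_vector_derivative_transform_within_open[OF assms(3)[OF Suc.prems] assms(1) Suc.prems])
      (simp add: Suc.IH)
  then show ?case by (simp add: nth_vderiv_Suc vector_derivative_at)
qed

lemma smooth_curve_onI:
  assumes "open I" and "\<And>t. t \<in> I \<Longrightarrow> g 0 t = f t"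
    and "\<And>k t. t \<in> I \<Longrightarrow> (g k has_vector_derivative g (Suc k) t) (at t)"
  shows "smooth_curve_on I f"
  unfolding smooth_curve_on_def
proof (intro allI ballI)
  fix k t assume t: "t \<in> I"
  have "(nth_vderiv k f has_vector_derivative g (Suc k) t) (at t)"
    by (rule has_vector_derivative_transform_within_open[OF assms(3)[OF t] assms(1) t])
      (simp add: nth_vderiv_eqI[OF assms])
  then show "nth_vderiv k f differentiable at t"
    by (rule differentiableI_vector)
qed

lemma smooth_curve_on_bounded_linear:
  assumes "open I" "smooth_curve_on I f" "bounded_linear L"
  shows "smooth_curve_on I (\<lambda>t. L (f t))"
proof (rule smooth_curve_onI[where g = "\<lambda>k t. L (nth_vderiv k f t)"])
  fix k t assume "t \<in> I"
  then show "((\<lambda>t. L (nth_vderiv k f t)) has_vector_derivative L (nth_vderiv (Suc k) f t)) (at t)"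
    by (intro bounded_linear.has_vector_derivative[OF assms(3)] smooth_curve_on_nth_vderiv[OF assms(2)])
qed (use assms in auto)

lemma smooth_curve_on_Pair:
  assumes "open I" "smooth_curve_on I f" "smooth_curve_on I g"
  shows "smooth_curve_on I (\<lambda>t. (f t, g t))"
proof (rule smooth_curve_onI[where g = "\<lambda>k t. (nth_vderiv k f t, nth_vderiv k g t)"])
  fix k t assume "t \<in> I"
  then show "((\<lambda>t. (nth_vderiv k f t, nth_vderiv k g t)) has_vector_derivative
      (nth_vderiv (Suc k) f t, nth_vderiv (Suc k) g t)) (at t)"
    by (intro has_vector_derivative_Pair smooth_curve_on_nth_vderiv[OF assms(2)]
        smooth_curve_on_nth_vderiv[OF assms(3)])
qed (use assms in auto)

lemma smooth_curve_on_Pair_iff: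
  assumes "open I"
  shows "smooth_curve_on I (\<lambda>t. (f t, g t)) \<longleftrightarrow> smooth_curve_on I f \<and> smooth_curve_on I g"
  using smooth_curve_on_Pair[OF assms, of f g]
    smooth_curve_on_bounded_linear[OF assms _ bounded_linear_fst, of "\<lambda>t. (f t, g t)"]
    smooth_curve_on_bounded_linear[OF assms _ bounded_linear_snd, of "\<lambda>t. (f t, g t)"]
  by auto

lemma has_vector_derivative_Pair_iff:
  "((\<lambda>t. (f t, g t)) has_vector_derivative (a, b)) (at t within S) \<longleftrightarrow>
   (f has_vector_derivative a) (at t within S) \<and> (g has_vector_derivative b) (at t within S)"
  using has_vector_derivative_Pair[of f a t S g b]
    bounded_linear.has_vector_derivative[OF bounded_linear_fst, of "\<lambda>t. (f t, g t)" "(a, b)" "at t within S"]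
    bounded_linear.has_vector_derivative[OF bounded_linear_snd, of "\<lambda>t. (f t, g t)" "(a, b)" "at t within S"]
  by auto

lemma jet_1:
  assumes "(f has_vector_derivative f') (at t)"
  shows "jet f t (Suc 0) = f'"
  using assms by (simp add: jet_def nth_vderiv_Suc vector_derivative_at)

lemma continuous_on_jet:
  assumes "open I" "smooth_curve_on I f"
  shows "continuous_on I (jet f)"
proof -
  have "continuous_on I (\<lambda>t. jet f t k)" for k
    using assms smooth_curve_on_nth_vderiv[OF assms(2)]
    by (auto simp: jet_def continuous_on_eq_continuous_at intro: has_vector_derivative_continuous)
  then show ?thesis by (rule continuous_on_coordinatewise_then_product)
qed

lemma smooth_curve_on_affine:
  fixes A B :: "'a::real_normed_vector"
  shows "smooth_curve_on UNIV (\<lambda>t. A + t *\<^sub>R B)"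
proof (rule smooth_curve_onI[where g = "\<lambda>k t. if k = 0 then A + t *\<^sub>R B else if k = 1 then B else 0"])
  fix k and t :: real
  show "((\<lambda>t. if k = 0 then A + t *\<^sub>R B else if k = 1 then B else 0) has_vector_derivative
      (if Suc k = 0 then A + t *\<^sub>R B else if Suc k = 1 then B else 0)) (at t)"
    by (cases k) (auto intro!: derivative_eq_intros)
qed auto

text \<open>The curve is the Taylor polynomial with coefficients \<open>j i / fact i\<close>, and
  \<open>g k\<close> is its \<open>k\<close>-th derivative. Matching finitely many entries is
  enough, since operators of finite order and basic open sets of the product topology see no
  more.\<close>

lemma polynomial_curve:
  fixes j :: "nat \<Rightarrow> 'a::real_normed_vector"
  obtains \<zeta> where "smooth_curve_on UNIV \<zeta>" "\<And>i. i \<le> N \<Longrightarrow> jet \<zeta> 0 i = j i"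
proof -
  define g where "g k t = (\<Sum>i\<le>N. if k \<le> i then (t ^ (i - k) / fact (i - k)) *\<^sub>R j i else 0)" for k and t :: real
  have g: "(g k has_vector_derivative g (Suc k) t) (at t)" for k t
    unfolding g_def
  proof (rule has_vector_derivative_sum)
    fix i
    have "((\<lambda>t. (t ^ n / fact n)) has_real_derivative
        (if n = 0 then 0 else t ^ (n - 1) / fact (n - 1))) (at t)" for n
    proof (cases n)
      case (Suc m)
      show ?thesis
        using DERIV_cdivide[OF DERIV_pow[of n t], of "fact n"] by (simp add: Suc del: of_nat_Suc)
    qed simp
    from bounded_linear.has_vector_derivative[OF bounded_linear_scaleR_left
        this[of "i - k", unfolded has_real_derivative_iff_has_vector_derivative]]
    have "((\<lambda>t. (t ^ (i - k) / fact (i - k)) *\<^sub>R j i) has_vector_derivative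
        (if i - k = 0 then 0 else t ^ (i - k - 1) / fact (i - k - 1)) *\<^sub>R j i) (at t)" .
    \<comment> \<open>For \<open>k = i\<close> the summand is constant, and its derivative 0 is the
      else branch at \<open>Suc k\<close>.\<close>
    then show "((\<lambda>t. if k \<le> i then (t ^ (i - k) / fact (i - k)) *\<^sub>R j i else 0) has_vector_derivative
        (if Suc k \<le> i then (t ^ (i - Suc k) / fact (i - Suc k)) *\<^sub>R j i else 0)) (at t)"
      by (cases "k \<le> i") (auto simp: split: if_splits)
  qed
  show ?thesis
  proof
    show "smooth_curve_on UNIV (g 0)"
      by (rule smooth_curve_onI[where g = g]) (auto intro: g)
    fix i assume i: "i \<le> N"
    have "jet (g 0) 0 i = g i 0"
      unfolding jet_def by (rule nth_vderiv_eqI[where I = UNIV]) (auto intro: g)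
    also have "\<dots> = (\<Sum>k\<le>N. if k = i then j i else 0)"
      unfolding g_def by (rule sum.cong) (auto simp: power_0_left)
    also have "\<dots> = j i" using i by simp
    finally show "jet (g 0) 0 i = j i" .
  qed
qed

section \<open>Smooth functions of jets\<close>

lemma jet_line_0 [simp]: "jet_line i e j 0 = j"
  by (simp add: jet_line_def)

lemma open_jet_line_vimage:
  fixes j :: "nat \<Rightarrow> 'a::real_normed_vector"
  assumes "open D"
  shows "open (jet_line i e j -` D)"
proof (rule open_vimage[OF assms])
  show "continuous_on UNIV (jet_line i e j)"
    unfolding jet_line_def
  proof (rule continuous_on_coordinatewise_then_product)
    show "continuous_on UNIV (\<lambda>s. (j(i := j i + s *\<^sub>R e)) k)" for k
      by (cases "k = i") (auto intro!: continuous_intros)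
  qed
qed

lemma jet_C_continuous: "jet_C n D F \<Longrightarrow> continuous_on D F"
  by (cases n) auto

lemma jet_C_Suc_has_derivative:
  assumes "jet_C (Suc n) D F" "e \<in> Basis" "j \<in> D"
  shows "((\<lambda>s. F (jet_line i e j s)) has_vector_derivative jet_partial i e F j) (at 0)"
  using assms by (simp add: jet_partial_def flip: vector_derivative_works)

text \<open>A coordinate line through a point of the open set \<open>D\<close> stays in
  \<open>D\<close> for a while, so partial derivatives on \<open>D\<close> do not depend on values
  outside.\<close>

lemma jet_C_cong:
  assumes "open D" "jet_C n D F" "\<And>j. j \<in> D \<Longrightarrow> F j = G j"
  shows "jet_C n D G"
  using assms(2,3)
proof (induction n arbitrary: F G)
  case 0
  then show ?case using continuous_on_cong by fastforce
next
  case (Suc n)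
  have der: "((\<lambda>s. G (jet_line i e j s)) has_vector_derivative jet_partial i e F j) (at 0)"
    if "e \<in> Basis" "j \<in> D" for i e j
    by (rule has_vector_derivative_transform_within_open
        [OF jet_C_Suc_has_derivative[OF Suc.prems(1) that] open_jet_line_vimage[OF assms(1)]])
      (use that Suc.prems in auto)
  have "jet_C n D (jet_partial i e G)" if "e \<in> Basis" for i e
  proof (rule Suc.IH)
    show "jet_C n D (jet_partial i e F)" using Suc.prems that by simp
    show "jet_partial i e F j = jet_partial i e G j" if "j \<in> D" for j
      using vector_derivative_at[OF der[OF \<open>e \<in> Basis\<close> that, of i]] by (simp add: jet_partial_def[of i e G])
  qed
  moreover have "continuous_on D G"
    using Suc.prems continuous_on_cong by fastforce
  ultimately show ?case by (simp add: differentiableI_vector[OF der])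
qed

text \<open>Frees the closure proofs from \<open>jet_partial\<close>: they may use any formula for
  the partial derivative that is valid on \<open>D\<close>.\<close>

lemma jet_C_SucI:
  assumes "open D" "continuous_on D F"
    and "\<And>i e. e \<in> Basis \<Longrightarrow> \<exists>G. (\<forall>j\<in>D. ((\<lambda>s. F (jet_line i e j s)) has_vector_derivative G j) (at 0)) \<and> jet_C n D G"
  shows "jet_C (Suc n) D F"
proof -
  have "(\<forall>j\<in>D. (\<lambda>s. F (jet_line i e j s)) differentiable at 0) \<and> jet_C n D (jet_partial i e F)"
    if e: "e \<in> Basis" for i e
  proof -
    obtain G where G: "\<And>j. j \<in> D \<Longrightarrow> ((\<lambda>s. F (jet_line i e j s)) has_vector_derivative G j) (at 0)"
      "jet_C n D G" using assms(3)[OF e] by blast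
    have "jet_C n D (jet_partial i e F)"
      by (rule jet_C_cong[OF assms(1) G(2)]) (simp add: jet_partial_def vector_derivative_at[OF G(1)])
    then show ?thesis using G(1) by (auto intro: differentiableI_vector)
  qed
  then show ?thesis using assms(2) by simp
qed

lemma jet_C_SucD: "jet_C (Suc n) D F \<Longrightarrow> jet_C n D F"
  by (induction n arbitrary: F) auto

section \<open>Closure properties of smooth functions of jets\<close>

lemma jet_C_const: "open D \<Longrightarrow> jet_C n D (\<lambda>_. c)"
proof (induction n arbitrary: c)
  case (Suc n)
  show ?case
    by (rule jet_C_SucI) (use Suc in \<open>auto intro!: exI[of _ "\<lambda>_. 0"] derivative_eq_intros\<close>)
qed simp

lemma continuous_on_jet_coord: "continuous_on D (\<lambda>j :: nat \<Rightarrow> 'a::euclidean_space. j k \<bullet> v)"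
  by (intro continuous_intros continuous_on_subset[OF continuous_on_product_coordinates]) auto

lemma jet_C_coord:
  assumes "open D"
  shows "jet_C n D (\<lambda>j. j k \<bullet> v)"
proof (cases n)
  case (Suc m)
  show ?thesis unfolding Suc
  proof (rule jet_C_SucI[OF assms continuous_on_jet_coord], intro exI conjI ballI)
    fix i and e :: 'a and j :: "nat \<Rightarrow> 'a"
    show "((\<lambda>s. jet_line i e j s k \<bullet> v) has_vector_derivative (if i = k then e \<bullet> v else 0)) (at 0)"
      by (cases "i = k") (auto simp: jet_line_def inner_add_left intro!: derivative_eq_intros)
  qed (rule jet_C_const[OF assms])
qed (simp add: continuous_on_jet_coord)

lemma jet_C_add:
  fixes F G :: "(nat \<Rightarrow> 'a::euclidean_space) \<Rightarrow> 'b::real_normed_vector"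
  assumes "open D" "jet_C n D F" "jet_C n D G"
  shows "jet_C n D (\<lambda>j. F j + G j)"
  using assms(2,3)
proof (induction n arbitrary: F G)
  case (Suc n)
  show ?case
  proof (rule jet_C_SucI[OF assms(1)], goal_cases)
    case (2 i e)
    show ?case
      by (rule exI[of _ "\<lambda>j. jet_partial i e F j + jet_partial i e G j"])
        (use 2 Suc in \<open>auto intro!: has_vector_derivative_add Suc.IH jet_C_Suc_has_derivative\<close>)
  qed (use Suc.prems in \<open>auto intro!: continuous_intros\<close>)
qed (auto intro!: continuous_intros)

lemma jet_C_mult:
  fixes F G :: "(nat \<Rightarrow> 'a::euclidean_space) \<Rightarrow> real"
  assumes "open D" "jet_C n D F" "jet_C n D G"
  shows "jet_C n D (\<lambda>j. F j * G j)"
  using assms(2,3)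
proof (induction n arbitrary: F G)
  case (Suc n)
  show ?case
  proof (rule jet_C_SucI[OF assms(1)], goal_cases)
    case (2 i e)
    show ?case
    proof (intro exI conjI ballI)
      show "jet_C n D (\<lambda>j. F j * jet_partial i e G j + jet_partial i e F j * G j)"
      proof (intro jet_C_add[OF assms(1)] Suc.IH)
        show "jet_C n D (jet_partial i e F)" "jet_C n D (jet_partial i e G)"
          using 2 Suc.prems by simp_all
      qed (rule jet_C_SucD[OF Suc.prems(1)] jet_C_SucD[OF Suc.prems(2)])+
      show "((\<lambda>s. F (jet_line i e j s) * G (jet_line i e j s)) has_vector_derivative
          F j * jet_partial i e G j + jet_partial i e F j * G j) (at 0)" if "j \<in> D" for j
        using has_vector_derivative_mult[OF jet_C_Suc_has_derivative[OF Suc.prems(1) 2 that]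
            jet_C_Suc_has_derivative[OF Suc.prems(2) 2 that]] by simp
    qed
  qed (use Suc.prems in \<open>auto intro!: continuous_intros\<close>)
qed (auto intro!: continuous_intros)

text \<open>The chain rule, with the outer derivative \<open>H\<close> already composed with
  \<open>F\<close>. For the inverse and the square root \<open>H\<close> is built from the composed
  function itself, so its smoothness of order \<open>n\<close> is the induction hypothesis; for
  arctan it is rational in \<open>F\<close>.\<close>

lemma jet_C_compose:
  fixes F :: "(nat \<Rightarrow> 'a::euclidean_space) \<Rightarrow> real"
  assumes "open D" "jet_C (Suc n) D F" "continuous_on D (\<lambda>j. h (F j))"
    and "\<And>j. j \<in> D \<Longrightarrow> (h has_real_derivative H j) (at (F j))" "jet_C n D H"
  shows "jet_C (Suc n) D (\<lambda>j. h (F j))"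
proof (rule jet_C_SucI[OF assms(1,3)], intro exI conjI ballI)
  fix i and e :: 'a assume e: "e \<in> Basis"
  show "jet_C n D (\<lambda>j. H j * jet_partial i e F j)"
    using assms e by (intro jet_C_mult) auto
  show "((\<lambda>s. h (F (jet_line i e j s))) has_vector_derivative H j * jet_partial i e F j) (at 0)"
    if "j \<in> D" for j
    using DERIV_chain2[of h "H j" "\<lambda>s. F (jet_line i e j s)" 0 "jet_partial i e F j"]
      assms(4)[OF that] jet_C_Suc_has_derivative[OF assms(2) e that, of i]
    by (simp add: has_real_derivative_iff_has_vector_derivative)
qed

lemma jet_C_inverse:
  fixes F :: "(nat \<Rightarrow> 'a::euclidean_space) \<Rightarrow> real"
  assumes "open D" "jet_C n D F" "\<And>j. j \<in> D \<Longrightarrow> F j \<noteq> 0"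
  shows "jet_C n D (\<lambda>j. inverse (F j))"
  using assms(2)
proof (induction n)
  case (Suc n)
  have IH: "jet_C n D (\<lambda>j. inverse (F j))" using Suc jet_C_SucD by blast
  show ?case
  proof (rule jet_C_compose[OF assms(1) Suc.prems, where H = "\<lambda>j. - 1 * (inverse (F j) * inverse (F j))"])
    show "jet_C n D (\<lambda>j. - 1 * (inverse (F j) * inverse (F j)))"
      by (intro jet_C_mult jet_C_const IH assms(1))
    show "continuous_on D (\<lambda>j. inverse (F j))"
      using assms(3) jet_C_continuous[OF Suc.prems] by (intro continuous_on_inverse) auto
    show "(inverse has_real_derivative - 1 * (inverse (F j) * inverse (F j))) (at (F j))" if "j \<in> D" for j
      using DERIV_inverse[OF assms(3)[OF that]] by simp
  qed
qed (use assms in \<open>auto intro!: continuous_intros\<close>)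

lemma jet_C_sqrt:
  fixes F :: "(nat \<Rightarrow> 'a::euclidean_space) \<Rightarrow> real"
  assumes "open D" "jet_C n D F" "\<And>j. j \<in> D \<Longrightarrow> F j > 0"
  shows "jet_C n D (\<lambda>j. sqrt (F j))"
  using assms(2)
proof (induction n)
  case (Suc n)
  have IH: "jet_C n D (\<lambda>j. sqrt (F j))" using Suc jet_C_SucD by blast
  show ?case
  proof (rule jet_C_compose[OF assms(1) Suc.prems, where H = "\<lambda>j. inverse (sqrt (F j)) * (1 / 2)"])
    show "jet_C n D (\<lambda>j. inverse (sqrt (F j)) * (1 / 2))"
      using assms(3) by (intro jet_C_mult jet_C_inverse jet_C_const IH assms(1)) (simp add: less_imp_neq[symmetric])
  qed (use assms(3) jet_C_continuous[OF Suc.prems] in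
        \<open>auto intro!: continuous_intros DERIV_real_sqrt simp flip: divide_inverse\<close>)
qed (use assms in \<open>auto intro!: continuous_intros\<close>)

lemma jet_C_arctan:
  fixes F :: "(nat \<Rightarrow> 'a::euclidean_space) \<Rightarrow> real"
  assumes "open D" "jet_C n D F"
  shows "jet_C n D (\<lambda>j. arctan (F j))"
proof (cases n)
  case (Suc m)
  have nz: "1 + x * x \<noteq> 0" for x :: real
    by (metis add_pos_nonneg less_irrefl zero_le_square zero_less_one)
  show ?thesis unfolding Suc
  proof (rule jet_C_compose[OF assms(1), where h = arctan and H = "\<lambda>j. inverse (1 + F j * F j)"])
    show "jet_C m D (\<lambda>j. inverse (1 + F j * F j))"
      using assms nz jet_C_SucD[of m D F] Suc
      by (intro jet_C_inverse jet_C_add jet_C_mult jet_C_const) simp_all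
    show "jet_C (Suc m) D F" using assms Suc by simp
    show "continuous_on D (\<lambda>j. arctan (F j))"
      using jet_C_continuous[OF assms(2)] by (rule continuous_on_arctan)
    show "(arctan has_real_derivative inverse (1 + F j * F j)) (at (F j))" for j
      using DERIV_arctan[of "F j"] by (simp add: power2_eq_square)
  qed
qed (use assms in \<open>auto intro!: continuous_intros\<close>)

lemma jet_C_Pair:
  assumes "open D" "jet_C n D F" "jet_C n D G"
  shows "jet_C n D (\<lambda>j. (F j, G j))"
  using assms(2,3)
proof (induction n arbitrary: F G)
  case (Suc n)
  show ?case
  proof (rule jet_C_SucI[OF assms(1)], goal_cases)
    case (2 i e)
    show ?case
      by (rule exI[of _ "\<lambda>j. (jet_partial i e F j, jet_partial i e G j)"])
        (use 2 Suc in \<open>auto intro!: has_vector_derivative_Pair Suc.IH jet_C_Suc_has_derivative\<close>)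
  qed (use Suc.prems in \<open>auto intro!: continuous_intros\<close>)
qed (auto intro!: continuous_intros)

lemma jet_smooth_on_Pair:
  "jet_smooth_on D F \<Longrightarrow> jet_smooth_on D G \<Longrightarrow> jet_smooth_on D (\<lambda>j. (F j, G j))"
  by (simp add: jet_smooth_on_def jet_C_Pair)

section \<open>Differential functions\<close>

text \<open>A syntactic class of real functions of jets of order at most \<open>m\<close>, smooth on \<open>D\<close>, that is
  closed under total differentiation.\<close>

inductive dfun :: "(nat \<Rightarrow> 'a::euclidean_space) set \<Rightarrow> nat \<Rightarrow> ((nat \<Rightarrow> 'a) \<Rightarrow> real) \<Rightarrow> bool" for D where
  const: "dfun D m (\<lambda>_. c)"
| coord: "i \<le> m \<Longrightarrow> dfun D m (\<lambda>j. j i \<bullet> v)"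
| add: "dfun D m F \<Longrightarrow> dfun D m G \<Longrightarrow> dfun D m (\<lambda>j. F j + G j)"
| mult: "dfun D m F \<Longrightarrow> dfun D m G \<Longrightarrow> dfun D m (\<lambda>j. F j * G j)"
| inverse: "dfun D m F \<Longrightarrow> (\<And>j. j \<in> D \<Longrightarrow> F j \<noteq> 0) \<Longrightarrow> dfun D m (\<lambda>j. inverse (F j))"
| sqrt: "dfun D m F \<Longrightarrow> (\<And>j. j \<in> D \<Longrightarrow> F j > 0) \<Longrightarrow> dfun D m (\<lambda>j. sqrt (F j))"
| arctan: "dfun D m F \<Longrightarrow> dfun D m (\<lambda>j. arctan (F j))"

lemma dfun_mono:
  assumes "dfun D m F" "D' \<subseteq> D" "m \<le> m'"
  shows "dfun D' m' F"
  using assms by induction (simp_all add: dfun.intros subset_iff)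

lemma dfun_uminus: "dfun D m F \<Longrightarrow> dfun D m (\<lambda>j. - F j)"
  using dfun.mult[OF dfun.const[of D m "-1"], of F] by simp

lemma dfun_diff: "dfun D m F \<Longrightarrow> dfun D m G \<Longrightarrow> dfun D m (\<lambda>j. F j - G j)"
  using dfun.add[OF _ dfun_uminus, of D m F G] by simp

lemma dfun_divide:
  "dfun D m F \<Longrightarrow> dfun D m G \<Longrightarrow> (\<And>j. j \<in> D \<Longrightarrow> G j \<noteq> 0) \<Longrightarrow> dfun D m (\<lambda>j. F j / G j)"
  using dfun.mult[OF _ dfun.inverse, of D m F G] by (simp add: divide_inverse)

lemma dfun_power2: "dfun D m F \<Longrightarrow> dfun D m (\<lambda>j. (F j)\<^sup>2)"
  using dfun.mult[of D m F F] by (simp add: power2_eq_square)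

lemma dfun_fst: "i \<le> m \<Longrightarrow> dfun D m (\<lambda>j :: nat \<Rightarrow> 'a::euclidean_space \<times> 'b::euclidean_space. fst (j i) \<bullet> v)"
  using dfun.coord[of i m D "(v, 0)"] by (simp add: inner_prod_def)

lemma dfun_snd: "i \<le> m \<Longrightarrow> dfun D m (\<lambda>j :: nat \<Rightarrow> 'a::euclidean_space \<times> 'b::euclidean_space. snd (j i) \<bullet> v)"
  using dfun.coord[of i m D "(0, v)"] by (simp add: inner_prod_def)

lemmas dfun_intros = dfun.const dfun.add dfun.mult dfun_uminus dfun_diff dfun_divide dfun_power2
  dfun.sqrt dfun.arctan

lemma dfun_smooth:
  assumes "dfun D m F" "open D"
  shows "jet_smooth_on D F"
  using assms
  by induction (auto simp: jet_smooth_on_def intro: jet_C_const jet_C_coord jet_C_add jet_C_mult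
      jet_C_inverse jet_C_sqrt jet_C_arctan)

lemma dfun_continuous: "dfun D m F \<Longrightarrow> open D \<Longrightarrow> continuous_on D F"
  using dfun_smooth jet_C_continuous unfolding jet_smooth_on_def by blast

lemma dfun_order: "dfun D m F \<Longrightarrow> jet_order_le m F"
  unfolding jet_order_le_def
proof (intro allI impI)
  fix j j' :: "nat \<Rightarrow> 'a" assume "dfun D m F" "\<forall>i\<le>m. j i = j' i"
  then show "F j = F j'" by induction auto
qed

lemma jet_order_le_Pair:
  "jet_order_le m F \<Longrightarrow> jet_order_le m G \<Longrightarrow> jet_order_le m (\<lambda>j. (F j, G j))"
  unfolding jet_order_le_def by blast

text \<open>Characterised by its effect along curves, not by the sum of partial derivatives times
  next coordinates. This is the form that uniqueness of derivatives can use.\<close>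

definition total_derivative ::
    "(nat \<Rightarrow> 'a::euclidean_space) set \<Rightarrow> ((nat \<Rightarrow> 'a) \<Rightarrow> real) \<Rightarrow> ((nat \<Rightarrow> 'a) \<Rightarrow> real) \<Rightarrow> bool" where
  "total_derivative D F G \<longleftrightarrow> (\<forall>\<zeta> t. jet \<zeta> t \<in> D \<longrightarrow> (\<forall>k. nth_vderiv k \<zeta> differentiable at t) \<longrightarrow>
     ((\<lambda>s. F (jet \<zeta> s)) has_real_derivative G (jet \<zeta> t)) (at t))"

text \<open>Only a coordinate raises the order, from \<open>j i\<close> to \<open>j (Suc i)\<close>.
  The other cases stay in the class because the derivatives of inverse, square root and arctan are
  built from its own operations.\<close>

lemma dfun_total_derivative:
  assumes "dfun D m F"
  shows "\<exists>G. dfun D (Suc m) G \<and> total_derivative D F G"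
  using assms
proof induction
  case (const m c)
  show ?case
    by (intro exI[of _ "\<lambda>_. 0"] conjI dfun.const) (simp add: total_derivative_def)
next
  case (coord i m v)
  show ?case
  proof (intro exI conjI)
    show "dfun D (Suc m) (\<lambda>j. j (Suc i) \<bullet> v)" using coord by (intro dfun.coord) simp
    show "total_derivative D (\<lambda>j. j i \<bullet> v) (\<lambda>j. j (Suc i) \<bullet> v)"
      unfolding total_derivative_def jet_def
      by (auto simp: nth_vderiv_Suc vector_derivative_works has_real_derivative_iff_has_vector_derivative
          intro: bounded_linear.has_vector_derivative[OF bounded_linear_inner_left])
  qed
next
  case (add m F G)
  then obtain F' G' where *: "dfun D (Suc m) F'" "total_derivative D F F'"
    "dfun D (Suc m) G'" "total_derivative D G G'" by blast
  show ?case
    by (rule exI[of _ "\<lambda>j. F' j + G' j"])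
      (use * in \<open>auto simp: total_derivative_def intro!: dfun.add derivative_eq_intros\<close>)
next
  case (mult m F G)
  then obtain F' G' where *: "dfun D (Suc m) F'" "total_derivative D F F'"
    "dfun D (Suc m) G'" "total_derivative D G G'" by blast
  have "dfun D (Suc m) F" "dfun D (Suc m) G"
    using mult.hyps by (auto intro: dfun_mono)
  with * show ?case
    by (intro exI[of _ "\<lambda>j. F' j * G j + G' j * F j"])
      (auto simp: total_derivative_def intro!: dfun.add dfun.mult DERIV_mult)
next
  case (inverse m F)
  then obtain F' where *: "dfun D (Suc m) F'" "total_derivative D F F'" by blast
  have "dfun D (Suc m) F"
    using inverse.hyps by (auto intro: dfun_mono)
  with * inverse.hyps(2) show ?case
    by (intro exI[of _ "\<lambda>j. - (inverse (F j) * F' j * inverse (F j))"])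
      (auto simp: total_derivative_def intro!: dfun_uminus dfun.mult dfun.inverse DERIV_inverse')
next
  case (sqrt m F)
  then obtain F' where *: "dfun D (Suc m) F'" "total_derivative D F F'" by blast
  have F: "dfun D (Suc m) F"
    using sqrt.hyps by (auto intro: dfun_mono)
  show ?case
  proof (intro exI conjI)
    show "dfun D (Suc m) (\<lambda>j. inverse (sqrt (F j)) / 2 * F' j)"
      using * sqrt.hyps(2) F by (intro dfun_intros dfun.inverse) (auto simp: less_imp_neq[symmetric])
    show "total_derivative D (\<lambda>j. sqrt (F j)) (\<lambda>j. inverse (sqrt (F j)) / 2 * F' j)"
      unfolding total_derivative_def
    proof (intro allI impI DERIV_chain2[OF DERIV_real_sqrt])
      fix \<zeta> t assume "jet \<zeta> t \<in> D" "\<forall>k. nth_vderiv k \<zeta> differentiable at t"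
      then show "0 < F (jet \<zeta> t)" "((\<lambda>s. F (jet \<zeta> s)) has_real_derivative F' (jet \<zeta> t)) (at t)"
        using sqrt.hyps(2) *(2) by (auto simp: total_derivative_def)
    qed
  qed
next
  case (arctan m F)
  then obtain F' where *: "dfun D (Suc m) F'" "total_derivative D F F'" by blast
  have F: "dfun D (Suc m) F"
    using arctan.hyps by (auto intro: dfun_mono)
  have nz: "1 + x\<^sup>2 \<noteq> 0" for x :: real
    by (metis add_pos_nonneg less_irrefl zero_le_power2 zero_less_one)
  show ?case
  proof (intro exI conjI)
    show "dfun D (Suc m) (\<lambda>j. inverse (1 + (F j)\<^sup>2) * F' j)"
      using * F nz by (intro dfun_intros dfun.inverse) auto
    show "total_derivative D (\<lambda>j. arctan (F j)) (\<lambda>j. inverse (1 + (F j)\<^sup>2) * F' j)"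
      using * unfolding total_derivative_def by (auto intro!: DERIV_chain2[of arctan] DERIV_arctan)
  qed
qed

text \<open>A choice is enough: later proofs use the order, the membership in the class and the
  effect along curves, never a formula.\<close>

definition tderiv where
  "tderiv D m F = (SOME G. dfun D (Suc m) G \<and> total_derivative D F G)"

lemma tderiv:
  assumes "dfun D m F"
  shows dfun_tderiv: "dfun D (Suc m) (tderiv D m F)"
    and total_derivative_tderiv: "total_derivative D F (tderiv D m F)"
  using someI_ex[OF dfun_total_derivative[OF assms]] by (simp_all add: tderiv_def)

lemma total_derivativeD:
  assumes "total_derivative D F G" "smooth_curve_on I \<zeta>" "t \<in> I" "jet \<zeta> t \<in> D"
  shows "((\<lambda>s. F (jet \<zeta> s)) has_real_derivative G (jet \<zeta> t)) (at t)"
  using assms by (simp add: total_derivative_def smooth_curve_on_def)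

lemma smooth_curve_on_dfun:
  assumes "open I" "smooth_curve_on I \<zeta>" "\<And>t. t \<in> I \<Longrightarrow> jet \<zeta> t \<in> D" "dfun D m F"
  shows "smooth_curve_on I (\<lambda>t. F (jet \<zeta> t))"
proof -
  \<comment> \<open>The iterated total derivatives are the tower for
    \<open>smooth_curve_onI\<close>. The order \<open>m + k\<close> is tracked because
    \<open>tderiv\<close> takes it as an argument.\<close>
  define g where "g k = rec_nat F (\<lambda>k. tderiv D (m + k)) k" for k
  have g: "dfun D (m + k) (g k)" for k
    by (induction k) (use assms(4) dfun_tderiv in \<open>auto simp: g_def\<close>)
  show ?thesis
  proof (rule smooth_curve_onI[where g = "\<lambda>k t. g k (jet \<zeta> t)"])
    fix k t assume "t \<in> I"
    moreover have "total_derivative D (g k) (g (Suc k))"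
      using total_derivative_tderiv[OF g[of k]] by (simp add: g_def)
    ultimately show "((\<lambda>t. g k (jet \<zeta> t)) has_vector_derivative g (Suc k) (jet \<zeta> t)) (at t)"
      using total_derivativeD assms(2,3) has_real_derivative_iff_has_vector_derivative by blast
  qed (simp_all add: assms(1) g_def)
qed

section \<open>A criterion for flatness\<close>

text \<open>An open box contains arbitrary sequences, whereas \<open>J\<close> is only known to
  contain jets of curves. The finite order of a relation bridges this gap.\<close>

lemma differentially_independentI:
  fixes J D :: "(nat \<Rightarrow> 'z::euclidean_space) set"
  assumes "open D" "J \<subseteq> D" "J \<noteq> {}"
    and "\<And>\<zeta>. smooth_curve_on UNIV \<zeta> \<Longrightarrow> jet \<zeta> 0 \<in> D \<Longrightarrow> jet \<zeta> 0 \<in> J"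
  shows "differentially_independent J"
  unfolding differentially_independent_def
proof (intro conjI notI assms(3), elim exE)
  fix m W and F :: "(nat \<Rightarrow> 'z) \<Rightarrow> real"
  assume "differential_relation J m W F"
  then have W: "open W" and order: "jet_order_le m F" and int: "interior {j \<in> W. F j = 0} = {}"
    and ne: "W \<inter> J \<noteq> {}" and zero: "\<And>j. j \<in> W \<inter> J \<Longrightarrow> F j = 0"
    by (auto simp: differential_relation_def jet_smooth_on_def)
  obtain j0 where "j0 \<in> W \<inter> D" using ne assms(2) by blast
  moreover have "openin (product_topology (\<lambda>i::nat. euclidean) UNIV) (W \<inter> D)"
    using W assms(1) by (simp add: euclidean_product_topology open_Int)
  \<comment> \<open>A basic open box around \<open>j0\<close>; it restricts finitely many
    derivatives, all of index at most \<open>N\<close>.\<close>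
  ultimately obtain X where X: "j0 \<in> Pi\<^sub>E UNIV X" "\<And>i. open (X i)" "finite {i. X i \<noteq> UNIV}"
      "Pi\<^sub>E UNIV X \<subseteq> W \<inter> D"
    using product_topology_open_contains_basis[of "\<lambda>i::nat. euclidean :: 'z topology" UNIV "W \<inter> D" j0]
    by auto
  obtain N where N: "\<And>i. X i \<noteq> UNIV \<Longrightarrow> i \<le> N"
    using X(3) by (metis (mono_tags, lifting) finite_nat_set_iff_bounded_le mem_Collect_eq)
  have "F j = 0" if j: "j \<in> Pi\<^sub>E UNIV X" for j
  proof -
    \<comment> \<open>Agreement up to \<open>N\<close> keeps the jet in the box, hence in
      \<open>J\<close>; agreement up to \<open>m\<close> makes \<open>F\<close> take the same value
      as at \<open>j\<close>.\<close>
    obtain \<zeta> where \<zeta>: "smooth_curve_on UNIV \<zeta>" "\<And>i. i \<le> max m N \<Longrightarrow> jet \<zeta> 0 i = j i"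
      using polynomial_curve[where N = "max m N" and j = j] by blast
    have "jet \<zeta> 0 i \<in> X i" for i
      using \<zeta>(2)[of i] N[of i] j by (cases "X i = UNIV") (auto simp: PiE_iff)
    then have "jet \<zeta> 0 \<in> W \<inter> D" using X(4) by (auto simp: PiE_iff)
    then have "F (jet \<zeta> 0) = 0" using zero assms(4)[OF \<zeta>(1)] by simp
    moreover have "F (jet \<zeta> 0) = F j" using order \<zeta>(2) by (simp add: jet_order_le_def)
    ultimately show ?thesis by simp
  qed
  then have "Pi\<^sub>E UNIV X \<subseteq> {j \<in> W. F j = 0}" using X(4) by blast
  moreover have "open (Pi\<^sub>E UNIV X)" using X(2,3) by (intro open_PiE) auto
  ultimately show False using X(1) int by (metis interior_maximal empty_iff subsetD)
qed

text \<open>\<open>fwd\<close> and \<open>bwd\<close> say that \<open>D\<close> is the right domain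
  from both sides. Since \<open>bwd\<close> returns \<open>\<zeta>\<close> itself and not merely a
  curve equal to it on \<open>I\<close>, the jets agree without a locality argument.\<close>

lemma differentially_flatI:
  assumes "jet_smooth_on UNIV (\<lambda>j. \<Lambda> (fst (j 0)) (\<lambda>k. snd (j k)))" "\<And>x. jet_order_le l (\<Lambda> x)"
    and "jet_smooth_on D \<Phi>" "jet_smooth_on D \<Psi>" "jet_order_le m \<Phi>" "jet_order_le (m + 1) \<Psi>"
    and fwd: "\<And>I x u t. trajectory S X U I x u \<Longrightarrow> t \<in> I \<Longrightarrow>
      jet (output_curve \<Lambda> x u) t \<in> D \<and>
      x t = \<Phi> (jet (output_curve \<Lambda> x u) t) \<and> u t = \<Psi> (jet (output_curve \<Lambda> x u) t)"
    and bwd: "\<And>I \<zeta>. open I \<Longrightarrow> is_interval I \<Longrightarrow> smooth_curve_on I \<zeta> \<Longrightarrow> (\<And>t. t \<in> I \<Longrightarrow> jet \<zeta> t \<in> D) \<Longrightarrow>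
      \<exists>x u. trajectory S X U I x u \<and> output_curve \<Lambda> x u = \<zeta>"
    and "trajectory S X U I x u" "I \<noteq> {}"
  shows "differentially_flat S X U \<Lambda>"
proof -
  have D: "open D" using assms(3) by (simp add: jet_smooth_on_def)
  have sub: "output_jets S X U \<Lambda> \<subseteq> D" using fwd by (auto simp: output_jets_def)
  have "differentially_independent (output_jets S X U \<Lambda>)"
  proof (rule differentially_independentI[OF D sub])
    show "output_jets S X U \<Lambda> \<noteq> {}" using assms(9,10) by (auto simp: output_jets_def)
    fix \<zeta> :: "real \<Rightarrow> 'c" assume \<zeta>: "smooth_curve_on UNIV \<zeta>" "jet \<zeta> 0 \<in> D"
    \<comment> \<open>The jet varies continuously with time, so it remains in \<open>D\<close> on
      some interval around 0, where \<open>bwd\<close> applies.\<close>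
    have "open (jet \<zeta> -` D)"
      using continuous_on_jet[OF open_UNIV \<zeta>(1)] D by (rule open_vimage[rotated])
    then obtain \<epsilon> where \<epsilon>: "\<epsilon> > 0" "ball 0 \<epsilon> \<subseteq> jet \<zeta> -` D"
      using \<zeta>(2) open_contains_ball by (metis vimageI)
    have "smooth_curve_on (ball 0 \<epsilon>) \<zeta>" using \<zeta>(1) by (auto simp: smooth_curve_on_def)
    moreover have "jet \<zeta> t \<in> D" if "t \<in> ball 0 \<epsilon>" for t using \<epsilon>(2) that by blast
    ultimately obtain x u where "trajectory S X U (ball 0 \<epsilon>) x u" "output_curve \<Lambda> x u = \<zeta>"
      using bwd[of "ball 0 \<epsilon>" \<zeta>] is_interval_ball_real[of 0 \<epsilon>] by blast
    then show "jet \<zeta> 0 \<in> output_jets S X U \<Lambda>"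
      using \<epsilon>(1) unfolding output_jets_def by (auto intro!: exI[of _ "ball 0 \<epsilon>"] exI[of _ x] exI[of _ u] exI[of _ "0::real"])
  qed
  moreover have "\<exists>l D. (\<forall>x. jet_order_le l (\<Lambda> x)) \<and>
        jet_smooth_on D (\<lambda>j. \<Lambda> (fst (j 0)) (\<lambda>k. snd (j k))) \<and>
        (\<forall>I x u. trajectory S X U I x u \<longrightarrow> (\<forall>t\<in>I. jet (\<lambda>\<tau>. (x \<tau>, u \<tau>)) t \<in> D))"
    using assms(1,2) by blast
  moreover have "\<exists>m D \<Phi> \<Psi>. jet_order_le m \<Phi> \<and> jet_order_le (m + 1) \<Psi> \<and>
        jet_smooth_on D \<Phi> \<and> jet_smooth_on D \<Psi> \<and> output_jets S X U \<Lambda> \<subseteq> D \<and>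
        (\<forall>I x u. trajectory S X U I x u \<longrightarrow>
           (\<forall>t\<in>I. x t = \<Phi> (jet (output_curve \<Lambda> x u) t) \<and> u t = \<Psi> (jet (output_curve \<Lambda> x u) t)))"
    using assms(3-6) sub fwd by blast
  ultimately show ?thesis unfolding differentially_flat_def by blast
qed

section \<open>The heading of a planar velocity\<close>

text \<open>For a sign \<open>\<sigma>\<close> this is positive except for zero velocity and for the
  heading opposite to the branch centre. Its positivity is thus an open condition describing where
  \<open>heading\<close> is smooth.\<close>

definition heading_den :: "real \<Rightarrow> real \<Rightarrow> real \<Rightarrow> real \<Rightarrow> real" where
  "heading_den \<mu> \<sigma> x y = sqrt (x\<^sup>2 + y\<^sup>2) + \<sigma> * (y * cos \<mu> - x * sin \<mu>)"

text \<open>The angle \<open>\<theta>\<close> of the branch centred at \<open>\<mu>\<close> with \<open>(x, y) = v (- sin \<theta>, cos \<theta>)\<close> and \<open>\<sigma> v > 0\<close>.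
  With \<open>z = \<sigma> (y - \<i> x) exp (- \<i> \<mu>)\<close>, the angle \<open>\<theta> - \<mu>\<close> is the argument of \<open>z\<close>, computed by the
  half-angle formula \<open>2 arctan (Im z / (\<bar>z\<bar> + Re z))\<close>, which is smooth off the negative real axis.\<close>

definition heading :: "real \<Rightarrow> real \<Rightarrow> real \<Rightarrow> real \<Rightarrow> real" where
  "heading \<mu> \<sigma> x y = \<mu> + 2 * arctan (\<sigma> * (- x * cos \<mu> - y * sin \<mu>) / heading_den \<mu> \<sigma> x y)"

text \<open>With \<psi> half of \<theta> - \<mu>, denominator and numerator are
  \<open>2 * \<sigma> * v\<close> times \<open>cos \<psi> * cos \<psi>\<close> and
  \<open>sin \<psi> * cos \<psi>\<close>. The quotient is \<open>tan \<psi>\<close>, and \<psi> lies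
  where arctan inverts tan.\<close>

lemma heading_unique:
  assumes "\<sigma> \<in> {1, -1}" "\<sigma> * v > 0" "x = - v * sin \<theta>" "y = v * cos \<theta>" "\<bar>\<theta> - \<mu>\<bar> < pi"
  shows "heading_den \<mu> \<sigma> x y > 0" "heading \<mu> \<sigma> x y = \<theta>" "\<sigma> * sqrt (x\<^sup>2 + y\<^sup>2) = v"
proof -
  define \<psi> where "\<psi> = (\<theta> - \<mu>) / 2"
  have \<theta>: "\<theta> = \<mu> + 2 * \<psi>" by (simp add: \<psi>_def field_simps)
  have \<psi>: "- (pi / 2) < \<psi>" "\<psi> < pi / 2" using assms(5) by (auto simp: \<psi>_def)
  have cos: "cos \<psi> > 0" using \<psi> by (intro cos_gt_zero_pi) auto
  have "x\<^sup>2 + y\<^sup>2 = v\<^sup>2 * ((sin \<theta>)\<^sup>2 + (cos \<theta>)\<^sup>2)"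
    unfolding assms(3,4) by algebra
  then have "x\<^sup>2 + y\<^sup>2 = v\<^sup>2" by simp
  then have s: "sqrt (x\<^sup>2 + y\<^sup>2) = \<sigma> * v"
    using assms(1,2) by auto
  then show "\<sigma> * sqrt (x\<^sup>2 + y\<^sup>2) = v" using assms(1) by auto
  have "\<sigma> * (y * cos \<mu> - x * sin \<mu>) = \<sigma> * v * cos (\<theta> - \<mu>)"
    by (simp add: assms(3,4) cos_diff algebra_simps)
  also have "\<dots> = \<sigma> * v * (2 * (cos \<psi>)\<^sup>2 - 1)"
    by (simp add: \<theta> cos_double_cos)
  finally have den: "heading_den \<mu> \<sigma> x y = \<sigma> * v * (2 * (cos \<psi>)\<^sup>2)"
    unfolding heading_den_def s by (simp add: right_diff_distrib)
  then show "heading_den \<mu> \<sigma> x y > 0" using cos assms(2) by simp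
  have "\<sigma> * (- x * cos \<mu> - y * sin \<mu>) = \<sigma> * v * sin (\<theta> - \<mu>)"
    by (simp add: assms(3,4) sin_diff algebra_simps)
  also have "\<dots> = \<sigma> * v * (2 * sin \<psi> * cos \<psi>)"
    by (simp add: \<theta> sin_double)
  finally have num: "\<sigma> * (- x * cos \<mu> - y * sin \<mu>) = \<sigma> * v * (2 * sin \<psi> * cos \<psi>)" .
  have "heading \<mu> \<sigma> x y = \<mu> + 2 * arctan (\<sigma> * v * (2 * sin \<psi> * cos \<psi>) / (\<sigma> * v * (2 * (cos \<psi>)\<^sup>2)))"
    unfolding heading_def num den ..
  also have "\<sigma> * v * (2 * sin \<psi> * cos \<psi>) / (\<sigma> * v * (2 * (cos \<psi>)\<^sup>2)) = tan \<psi>"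
    using assms(2) cos by (auto simp: tan_def power2_eq_square)
  finally show "heading \<mu> \<sigma> x y = \<theta>" using \<psi> by (simp add: arctan_tan \<theta>)
qed

text \<open>\<open>R\<close> and \<open>J\<close> are the real and imaginary parts of the rotated
  velocity \<open>z\<close>. The proof shows that \<open>z\<close> has modulus \<open>s\<close> and
  argument \<open>2 * \<psi>\<close>, then rotates back by \<mu>.\<close>

lemma heading_exists:
  assumes "\<sigma> \<in> {1, -1}" "heading_den \<mu> \<sigma> x y > 0"
  shows "\<bar>heading \<mu> \<sigma> x y - \<mu>\<bar> < pi" "sqrt (x\<^sup>2 + y\<^sup>2) > 0"
    "x = - (\<sigma> * sqrt (x\<^sup>2 + y\<^sup>2)) * sin (heading \<mu> \<sigma> x y)"
    "y = \<sigma> * sqrt (x\<^sup>2 + y\<^sup>2) * cos (heading \<mu> \<sigma> x y)"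
proof -
  define s where "s = sqrt (x\<^sup>2 + y\<^sup>2)"
  define R where "R = \<sigma> * (y * cos \<mu> - x * sin \<mu>)"
  define J where "J = \<sigma> * (- x * cos \<mu> - y * sin \<mu>)"
  define \<psi> where "\<psi> = arctan (J / (s + R))"
  have h: "heading \<mu> \<sigma> x y = \<mu> + 2 * \<psi>" "s + R > 0"
    using assms(2) by (simp_all add: heading_def heading_den_def \<psi>_def J_def R_def s_def)
  then show "\<bar>heading \<mu> \<sigma> x y - \<mu>\<bar> < pi"
    using arctan_bounded[of "J / (s + R)"] by (auto simp: \<psi>_def abs_less_iff)
  have \<sigma>: "\<sigma>\<^sup>2 = 1" using assms(1) by auto
  have "x\<^sup>2 + y\<^sup>2 \<noteq> 0"
  proof
    assume "x\<^sup>2 + y\<^sup>2 = 0"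
    then have "x = 0" "y = 0" by (simp_all add: sum_power2_eq_zero_iff)
    then show False using assms(2) by (simp add: heading_den_def)
  qed
  then show s: "sqrt (x\<^sup>2 + y\<^sup>2) > 0" by (simp add: less_le)
  have s0: "s > 0" "s \<noteq> 0" using s by (auto simp: s_def)
  have s2: "s\<^sup>2 = x\<^sup>2 + y\<^sup>2" by (simp add: s_def)
  have "R\<^sup>2 + J\<^sup>2 = \<sigma>\<^sup>2 * ((x\<^sup>2 + y\<^sup>2) * ((sin \<mu>)\<^sup>2 + (cos \<mu>)\<^sup>2))"
    unfolding R_def J_def by algebra
  then have RJ: "R\<^sup>2 + J\<^sup>2 = s\<^sup>2" using \<sigma> s2 by simp
  have cos: "cos \<psi> > 0" unfolding \<psi>_def using arctan_bounded by (intro cos_gt_zero_pi) auto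
  have "sin \<psi> / cos \<psi> = J / (s + R)"
    using tan_arctan[of "J / (s + R)"] by (simp only: \<psi>_def tan_def)
  then have sc: "sin \<psi> * (s + R) = J * cos \<psi>" using cos h(2) by (simp add: field_simps)
  \<comment> \<open>Since \<open>R\<^sup>2 + J\<^sup>2 = s\<^sup>2\<close>, the sum
    \<open>(s + R)\<^sup>2 + J\<^sup>2\<close> is \<open>2 * s * (s + R)\<close>.\<close>
  have "(s + R) * (2 * s * (cos \<psi>)\<^sup>2) = ((s + R)\<^sup>2 + J\<^sup>2) * (cos \<psi>)\<^sup>2"
    using RJ by algebra
  also have "\<dots> = (s + R)\<^sup>2 * ((sin \<psi>)\<^sup>2 + (cos \<psi>)\<^sup>2)"
    using sc by algebra
  finally have "(s + R) * (2 * s * (cos \<psi>)\<^sup>2) = (s + R) * (s + R)"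
    by (simp only: sin_cos_squared_add mult_1_right power2_eq_square[of "s + R"])
  then have c2: "2 * s * (cos \<psi>)\<^sup>2 = s + R" using h(2) by simp
  then have "s * (2 * (cos \<psi>)\<^sup>2 - 1) = R" by (simp add: algebra_simps)
  then have C: "s * cos (2 * \<psi>) = R" by (simp only: cos_double_cos)
  have "(s + R) * (s * sin (2 * \<psi>)) = 2 * s * (cos \<psi> * (sin \<psi> * (s + R)))"
    by (simp add: sin_double)
  also have "\<dots> = (s + R) * J"
    unfolding sc using c2 by algebra
  finally have S: "s * sin (2 * \<psi>) = J" using h(2) by simp
  have "- (\<sigma> * s) * sin (\<mu> + 2 * \<psi>) = - \<sigma> * (sin \<mu> * R + cos \<mu> * J)"
    unfolding C[symmetric] S[symmetric] sin_add by algebra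
  also have "\<dots> = \<sigma>\<^sup>2 * (x * ((sin \<mu>)\<^sup>2 + (cos \<mu>)\<^sup>2))"
    unfolding R_def J_def by algebra
  finally show "x = - (\<sigma> * sqrt (x\<^sup>2 + y\<^sup>2)) * sin (heading \<mu> \<sigma> x y)"
    using \<sigma> unfolding h(1) s_def by simp
  have "\<sigma> * s * cos (\<mu> + 2 * \<psi>) = \<sigma> * (cos \<mu> * R - sin \<mu> * J)"
    unfolding C[symmetric] S[symmetric] cos_add by algebra
  also have "\<dots> = \<sigma>\<^sup>2 * (y * ((sin \<mu>)\<^sup>2 + (cos \<mu>)\<^sup>2))"
    unfolding R_def J_def by algebra
  finally show "y = \<sigma> * sqrt (x\<^sup>2 + y\<^sup>2) * cos (heading \<mu> \<sigma> x y)"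
    using \<sigma> unfolding h(1) s_def by simp
qed

text \<open>Positivity of \<open>heading_den\<close> excludes zero velocity, where the root would
  not be smooth.\<close>

lemma dfun_speed:
  assumes "dfun D m X" "dfun D m Y" "\<sigma> \<in> {1, -1}" "\<And>j. j \<in> D \<Longrightarrow> heading_den \<mu> \<sigma> (X j) (Y j) > 0"
  shows "dfun D m (\<lambda>j. sqrt ((X j)\<^sup>2 + (Y j)\<^sup>2))"
  using heading_exists(2)[OF assms(3,4)] assms(1,2) by (intro dfun_intros) auto

lemma dfun_heading:
  assumes "dfun D m X" "dfun D m Y" "\<sigma> \<in> {1, -1}" "\<And>j. j \<in> D \<Longrightarrow> heading_den \<mu> \<sigma> (X j) (Y j) > 0"
  shows "dfun D m (\<lambda>j. heading \<mu> \<sigma> (X j) (Y j))"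
proof -
  have "dfun D m (\<lambda>j. heading_den \<mu> \<sigma> (X j) (Y j))"
    unfolding heading_den_def using assms(1,2) by (intro dfun_intros dfun_speed[OF assms])
  with assms show ?thesis
    unfolding heading_def by (intro dfun_intros) (auto simp: less_imp_neq[symmetric])
qed

lemma open_heading_den:
  assumes "open D" "continuous_on D X" "continuous_on D Y"
  shows "open {j \<in> D. heading_den \<mu> \<sigma> (X j) (Y j) > 0}"
proof -
  have "continuous_on D (\<lambda>j. heading_den \<mu> \<sigma> (X j) (Y j))"
    unfolding heading_den_def using assms by (intro continuous_intros)
  then have "open ((\<lambda>j. heading_den \<mu> \<sigma> (X j) (Y j)) -` {0<..} \<inter> D)"
    using assms(1) by (simp add: continuous_on_open_vimage)
  also have "\<dots> = {j \<in> D. heading_den \<mu> \<sigma> (X j) (Y j) > 0}" by auto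
  finally show ?thesis .
qed

text \<open>Needed for a motion in which both bodies move in the same direction. Modulo
  \<open>2 * pi\<close> the angles must agree, or differ by \<open>pi\<close> if the signs differ.
  Rounding brings the shifted second centre within \<open>pi\<close> of \<mu>, and the midpoint is
  then within \<open>pi / 2\<close> of both, so both bounds are strict.\<close>

lemma heading_compatible:
  assumes "\<sigma> \<in> {1, -1}" "\<sigma>' \<in> {1, -1}"
  obtains \<theta> \<theta>' where "\<bar>\<theta> - \<mu>\<bar> < pi" "\<bar>\<theta>' - \<mu>'\<bar> < pi"
    "\<sigma> * sin \<theta> = \<sigma>' * sin \<theta>'" "\<sigma> * cos \<theta> = \<sigma>' * cos \<theta>'"
proof -
  define \<delta> where "\<delta> = (if \<sigma> = \<sigma>' then 0 else pi)"
  define k where "k = round ((\<mu> - \<mu>' - \<delta>) / (2 * pi))"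
  define d where "d = \<mu>' + \<delta> + 2 * pi * of_int k - \<mu>"
  have "\<bar>of_int k - (\<mu> - \<mu>' - \<delta>) / (2 * pi)\<bar> \<le> 1 / 2"
    unfolding k_def by (rule of_int_round_abs_le)
  moreover have "d = 2 * pi * (of_int k - (\<mu> - \<mu>' - \<delta>) / (2 * pi))"
    by (simp add: d_def field_simps)
  ultimately have "\<bar>d\<bar> \<le> pi" by (simp add: abs_mult)
  then have d: "\<bar>d\<bar> < 2 * pi" using pi_gt_zero by linarith
  have \<theta>: "\<mu> + d / 2 = (\<mu>' - d / 2 + \<delta>) + of_int k * (2 * pi)"
    by (simp add: d_def field_simps)
  have "sin (\<mu> + d / 2) = sin (\<mu>' - d / 2 + \<delta>)" "cos (\<mu> + d / 2) = cos (\<mu>' - d / 2 + \<delta>)"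
    unfolding \<theta> by (simp_all add: sin_add cos_add sin_integer_2pi cos_integer_2pi mult.commute[of "of_int k"])
  then show ?thesis
    using d assms by (intro that[of "\<mu> + d / 2" "\<mu>' - d / 2"]) (auto simp: \<delta>_def)
qed

section \<open>The slider-pusher system\<close>

locale slider_pusher_branch =
  fixes \<alpha> \<beta> \<mu>\<^sub>s \<mu>\<^sub>p \<sigma>\<^sub>n \<sigma>\<^sub>p :: real
  assumes \<beta>: "\<beta> > 0" and \<sigma>\<^sub>n: "\<sigma>\<^sub>n \<in> {1, -1}" and \<sigma>\<^sub>p: "\<sigma>\<^sub>p \<in> {1, -1}"
begin

text \<open>State and input as functions of the jet of \<open>(x\<^sub>s, y\<^sub>s)\<close>.  A prime marks a total derivative,
  and \<open>w\<close> is the signed speed of the slider.\<close>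

definition dom_s :: "(nat \<Rightarrow> real \<times> real) set" where
  "dom_s = {j. heading_den \<mu>\<^sub>s \<sigma>\<^sub>n (fst (j 1)) (snd (j 1)) > 0}"

definition w :: "(nat \<Rightarrow> real \<times> real) \<Rightarrow> real" where
  "w j = \<sigma>\<^sub>n * sqrt ((fst (j 1))\<^sup>2 + (snd (j 1))\<^sup>2)"

definition \<theta>s :: "(nat \<Rightarrow> real \<times> real) \<Rightarrow> real" where
  "\<theta>s j = heading \<mu>\<^sub>s \<sigma>\<^sub>n (fst (j 1)) (snd (j 1))"

text \<open>The number given to \<open>tderiv\<close> is the order of the function differentiated;
  the result has order one more.\<close>

definition "\<theta>s' = tderiv dom_s 1 \<theta>s"

text \<open>A quotient of velocity components, so that it lies in \<open>dfun\<close>; on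
  \<open>dom_s\<close> it is the cosine of \<open>\<theta>s\<close>.\<close>

definition "cos_s j = snd (j 1) / w j"

definition "sin_s j = - fst (j 1) / w j"

definition "c j = \<beta>\<^sup>2 * \<theta>s' j / w j"

definition "c' = tderiv dom_s 2 c"

definition "vn j = w j * (\<beta>\<^sup>2 + (c j)\<^sup>2) / \<beta>\<^sup>2"

definition "vt j = c' j + \<alpha> * \<theta>s' j"

definition "xp j = fst (j 0) + c j * cos_s j + \<alpha> * sin_s j"

definition "yp j = snd (j 0) + c j * sin_s j - \<alpha> * cos_s j"

text \<open>The vector \<open>(vt, vn)\<close> rotated by \<open>\<theta>s\<close>. It is the
  velocity of the pusher because \<open>c' + \<alpha> * \<theta>s' = vt\<close> and
  \<open>w + c * \<theta>s' = vn\<close>.\<close>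

definition "xp' j = vt j * cos_s j - vn j * sin_s j"

definition "yp' j = vt j * sin_s j + vn j * cos_s j"

text \<open>On \<open>dom_s\<close> the pusher has speed
  \<open>sqrt (vt\<^sup>2 + vn\<^sup>2) > 0\<close>, so the extra condition only removes headings
  opposite to the branch centre.\<close>

definition "dom_p = {j \<in> dom_s. heading_den \<mu>\<^sub>p \<sigma>\<^sub>p (xp' j) (yp' j) > 0}"

definition "vp j = \<sigma>\<^sub>p * sqrt ((xp' j)\<^sup>2 + (yp' j)\<^sup>2)"

definition "\<theta>p j = heading \<mu>\<^sub>p \<sigma>\<^sub>p (xp' j) (yp' j)"

definition "\<theta>p' = tderiv dom_p 3 \<theta>p"

definition "flat_state j = (fst (j 0), snd (j 0), \<theta>s j, c j, xp j, yp j, \<theta>p j)"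

definition "flat_input j = (vt j, vn j, vp j, \<theta>p' j)"

section \<open>Domains, orders and smoothness of the flat formulas\<close>

lemma dfun_coords:
  "i \<le> m \<Longrightarrow> dfun D m (\<lambda>j :: nat \<Rightarrow> real \<times> real. fst (j i))"
  "i \<le> m \<Longrightarrow> dfun D m (\<lambda>j :: nat \<Rightarrow> real \<times> real. snd (j i))"
  using dfun_fst[of i m D "1::real"] dfun_snd[of i m D "1::real"] by simp_all

lemma open_dom_s: "open dom_s"
  unfolding dom_s_def
  using open_heading_den[OF open_UNIV dfun_continuous[OF dfun_coords(1)[OF order_refl, of _ 1] open_UNIV]
      dfun_continuous[OF dfun_coords(2)[OF order_refl, of _ 1] open_UNIV]] by simp

lemma dom_s:
  assumes "j \<in> dom_s"
  shows "\<sigma>\<^sub>n * w j > 0" "fst (j 1) = - w j * sin (\<theta>s j)" "snd (j 1) = w j * cos (\<theta>s j)"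
    "\<bar>\<theta>s j - \<mu>\<^sub>s\<bar> < pi" "w j \<noteq> 0" "cos_s j = cos (\<theta>s j)" "sin_s j = sin (\<theta>s j)"
proof -
  note * = heading_exists[OF \<sigma>\<^sub>n, of \<mu>\<^sub>s "fst (j 1)" "snd (j 1)"]
  show "\<sigma>\<^sub>n * w j > 0" "fst (j 1) = - w j * sin (\<theta>s j)" "snd (j 1) = w j * cos (\<theta>s j)"
    "\<bar>\<theta>s j - \<mu>\<^sub>s\<bar> < pi" "w j \<noteq> 0"
    using * assms \<sigma>\<^sub>n unfolding dom_s_def w_def \<theta>s_def by auto
  then show "cos_s j = cos (\<theta>s j)" "sin_s j = sin (\<theta>s j)"
    by (simp_all add: cos_s_def sin_s_def)
qed

lemma dfun_s:
  shows dfun_w: "dfun dom_s 1 w" and dfun_\<theta>s: "dfun dom_s 1 \<theta>s" and dfun_\<theta>s': "dfun dom_s 2 \<theta>s'"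
    and dfun_cos_s: "dfun dom_s 1 cos_s" and dfun_sin_s: "dfun dom_s 1 sin_s"
    and dfun_c: "dfun dom_s 2 c" and dfun_c': "dfun dom_s 3 c'"
    and dfun_vn: "dfun dom_s 2 vn" and dfun_vt: "dfun dom_s 3 vt"
    and dfun_xp: "dfun dom_s 2 xp" and dfun_yp: "dfun dom_s 2 yp"
    and dfun_xp': "dfun dom_s 3 xp'" and dfun_yp': "dfun dom_s 3 yp'"
proof -
  note mono = dfun_mono[OF _ order_refl]
  have \<beta>2: "\<beta>\<^sup>2 \<noteq> 0" using \<beta> by simp
  have den: "heading_den \<mu>\<^sub>s \<sigma>\<^sub>n (fst (j 1)) (snd (j 1)) > 0" if "j \<in> dom_s" for j
    using that by (simp add: dom_s_def)
  show w: "dfun dom_s 1 w"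
    unfolding w_def by (intro dfun.mult dfun.const dfun_speed[OF _ _ \<sigma>\<^sub>n den] dfun_coords) simp_all
  show \<theta>s: "dfun dom_s 1 \<theta>s"
    unfolding \<theta>s_def by (intro dfun_heading[OF _ _ \<sigma>\<^sub>n den] dfun_coords) simp_all
  show \<theta>s': "dfun dom_s 2 \<theta>s'"
    using dfun_tderiv[OF \<theta>s] by (simp add: \<theta>s'_def numeral_2_eq_2)
  show cos_s: "dfun dom_s 1 cos_s" and sin_s: "dfun dom_s 1 sin_s"
    unfolding cos_s_def sin_s_def by (intro dfun_intros dfun_coords w dom_s(5); simp)+
  show c: "dfun dom_s 2 c"
    unfolding c_def by (intro dfun_intros \<theta>s' mono[OF w] dom_s(5)) simp_all
  show c': "dfun dom_s 3 c'"
    using dfun_tderiv[OF c] by (simp add: c'_def numeral_3_eq_3 numeral_2_eq_2)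
  show vn: "dfun dom_s 2 vn"
    unfolding vn_def by (intro dfun_intros c mono[OF w] \<beta>2) simp_all
  show vt: "dfun dom_s 3 vt"
    unfolding vt_def by (intro dfun_intros c' mono[OF \<theta>s']) simp_all
  show "dfun dom_s 2 xp" "dfun dom_s 2 yp"
    unfolding xp_def yp_def
    by (intro dfun_intros dfun_coords c mono[OF cos_s] mono[OF sin_s]; simp)+
  show "dfun dom_s 3 xp'" "dfun dom_s 3 yp'"
    unfolding xp'_def yp'_def
    by (intro dfun_intros vt mono[OF vn] mono[OF cos_s] mono[OF sin_s]; simp)+
qed

lemma open_dom: "open dom_p"
  unfolding dom_p_def
  by (intro open_heading_den open_dom_s dfun_continuous[OF dfun_xp'] dfun_continuous[OF dfun_yp'])

lemma dom_subset: "dom_p \<subseteq> dom_s"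
  by (auto simp: dom_p_def)

lemma dom_p:
  assumes "j \<in> dom_p"
  shows "\<sigma>\<^sub>p * vp j > 0" "xp' j = - vp j * sin (\<theta>p j)" "yp' j = vp j * cos (\<theta>p j)"
    "\<bar>\<theta>p j - \<mu>\<^sub>p\<bar> < pi"
  using heading_exists[OF \<sigma>\<^sub>p, of \<mu>\<^sub>p "xp' j" "yp' j"] assms \<sigma>\<^sub>p unfolding dom_p_def vp_def \<theta>p_def by auto

lemma dfun_p:
  shows dfun_vp: "dfun dom_p 3 vp" and dfun_\<theta>p: "dfun dom_p 3 \<theta>p" and dfun_\<theta>p': "dfun dom_p 4 \<theta>p'"
proof -
  have den: "heading_den \<mu>\<^sub>p \<sigma>\<^sub>p (xp' j) (yp' j) > 0" if "j \<in> dom_p" for j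
    using that by (simp add: dom_p_def)
  note P = dfun_mono[OF dfun_xp' dom_subset order_refl] dfun_mono[OF dfun_yp' dom_subset order_refl]
  show "dfun dom_p 3 vp"
    unfolding vp_def by (intro dfun.mult dfun.const dfun_speed[OF P \<sigma>\<^sub>p den])
  show \<theta>p: "dfun dom_p 3 \<theta>p"
    unfolding \<theta>p_def by (intro dfun_heading[OF P \<sigma>\<^sub>p den])
  show "dfun dom_p 4 \<theta>p'"
    using dfun_tderiv[OF \<theta>p] by (simp add: \<theta>p'_def)
qed

lemma dfun_dom:
  "dfun dom_p 3 (\<lambda>j. fst (j 0))" "dfun dom_p 3 (\<lambda>j. snd (j 0))"
  "dfun dom_p 3 \<theta>s" "dfun dom_p 3 c" "dfun dom_p 3 xp" "dfun dom_p 3 yp" "dfun dom_p 3 \<theta>p"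
  "dfun dom_p 4 vt" "dfun dom_p 4 vn" "dfun dom_p 4 vp" "dfun dom_p 4 \<theta>p'"
  using dfun_s dfun_p by (auto intro: dfun_coords dfun_mono[OF _ dom_subset] dfun_mono[OF _ order_refl])

lemma smooth_flat_state: "jet_smooth_on dom_p flat_state"
  unfolding flat_state_def by (intro jet_smooth_on_Pair dfun_dom[THEN dfun_smooth] open_dom)

lemma smooth_flat_input: "jet_smooth_on dom_p flat_input"
  unfolding flat_input_def by (intro jet_smooth_on_Pair dfun_dom[THEN dfun_smooth] open_dom)

lemma order_flat_state: "jet_order_le 3 flat_state"
  unfolding flat_state_def by (intro jet_order_le_Pair dfun_dom[THEN dfun_order])

lemma order_flat_input: "jet_order_le (3 + 1) flat_input"
proof -
  have "jet_order_le 4 flat_input"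
    unfolding flat_input_def by (intro jet_order_le_Pair dfun_dom[THEN dfun_order])
  then show ?thesis by simp
qed

lemma total_derivatives:
  "total_derivative dom_s \<theta>s \<theta>s'" "total_derivative dom_s c c'" "total_derivative dom_p \<theta>p \<theta>p'"
  unfolding \<theta>s'_def c'_def \<theta>p'_def
  by (intro total_derivative_tderiv dfun_\<theta>s dfun_c dfun_\<theta>p)+

section \<open>Passing between trajectories and output curves\<close>

abbreviation position_output :: "sp_state \<Rightarrow> (nat \<Rightarrow> sp_input) \<Rightarrow> real \<times> real" where
  "position_output \<equiv> \<lambda>(x\<^sub>s, y\<^sub>s, \<theta>\<^sub>s, c, x\<^sub>p, y\<^sub>p, \<theta>\<^sub>p) _. (x\<^sub>s, y\<^sub>s)"

text \<open>Branches and signs make \<open>heading_unique\<close> applicable to both velocities. An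
  identity that is differentiated afterwards is proved at all times of \<open>I\<close>, not just at
  \<open>t\<close>.\<close>

lemma flat_of_trajectory:
  assumes "trajectory (slider_pusher \<alpha> \<beta>) (sp_states \<mu>\<^sub>s \<mu>\<^sub>p) (sp_inputs \<sigma>\<^sub>n \<sigma>\<^sub>p) I X U" "t \<in> I"
  shows "jet (output_curve position_output X U) t \<in> dom_p \<and>
    X t = flat_state (jet (output_curve position_output X U) t) \<and>
    U t = flat_input (jet (output_curve position_output X U) t)"
proof -
  obtain x y \<theta> cc xq yq \<phi> where X: "X = (\<lambda>t. (x t, y t, \<theta> t, cc t, xq t, yq t, \<phi> t))"
    using that[of "\<lambda>t. fst (X t)" "\<lambda>t. fst (snd (X t))" "\<lambda>t. fst (snd (snd (X t)))"
        "\<lambda>t. fst (snd (snd (snd (X t))))" "\<lambda>t. fst (snd (snd (snd (snd (X t)))))"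
        "\<lambda>t. fst (snd (snd (snd (snd (snd (X t))))))" "\<lambda>t. snd (snd (snd (snd (snd (snd (X t))))))"] by simp
  obtain ut un up u\<omega> where U: "U = (\<lambda>t. (ut t, un t, up t, u\<omega> t))"
    using that[of "\<lambda>t. fst (U t)" "\<lambda>t. fst (snd (U t))" "\<lambda>t. fst (snd (snd (U t)))"
        "\<lambda>t. snd (snd (snd (U t)))"] by simp
  define \<zeta> where "\<zeta> = (\<lambda>t. (x t, y t))"
  have out: "output_curve position_output X U = \<zeta>" by (simp add: output_curve_def X \<zeta>_def)
  have I: "open I" and smooth: "smooth_curve_on I X"
    using assms(1) by (auto simp: trajectory_def)
  have \<zeta>: "smooth_curve_on I \<zeta>"
    using smooth unfolding X \<zeta>_def by (simp add: smooth_curve_on_Pair_iff[OF I])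
  \<comment> \<open>The signed speed of the slider, to be identified with \<open>w\<close>.\<close>
  define v where "v t = \<beta>\<^sup>2 / (\<beta>\<^sup>2 + (cc t)\<^sup>2) * un t" for t
  have pos: "\<beta>\<^sup>2 + (cc t)\<^sup>2 > 0" for t using \<beta> by (simp add: add_pos_nonneg)
  have eqs:
    "(x has_real_derivative - v t * sin (\<theta> t)) (at t)" "(y has_real_derivative v t * cos (\<theta> t)) (at t)"
    "(\<theta> has_real_derivative cc t / (\<beta>\<^sup>2 + (cc t)\<^sup>2) * un t) (at t)"
    "(cc has_real_derivative ut t - \<alpha> * (cc t / (\<beta>\<^sup>2 + (cc t)\<^sup>2)) * un t) (at t)"
    "xq t = x t + cc t * cos (\<theta> t) + \<alpha> * sin (\<theta> t)"
    "yq t = y t + cc t * sin (\<theta> t) - \<alpha> * cos (\<theta> t)"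
    "(xq has_real_derivative - up t * sin (\<phi> t)) (at t)" "(yq has_real_derivative up t * cos (\<phi> t)) (at t)"
    "(\<phi> has_real_derivative u\<omega> t) (at t)"
    "\<bar>\<theta> t - \<mu>\<^sub>s\<bar> < pi" "\<bar>\<phi> t - \<mu>\<^sub>p\<bar> < pi" "\<sigma>\<^sub>n * un t > 0" "\<sigma>\<^sub>p * up t > 0"
    if t: "t \<in> I" for t
  proof -
    obtain d1 d2 d3 d4 d5 d6 d7 where d: "vector_derivative X (at t) = (d1, d2, d3, d4, d5, d6, d7)"
      by (metis surj_pair)
    have "(X has_vector_derivative vector_derivative X (at t)) (at t)"
      using smooth_curve_on_nth_vderiv[OF smooth t, of 0] by (simp add: nth_vderiv_Suc)
    then have "(x has_real_derivative d1) (at t)" "(y has_real_derivative d2) (at t)"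
      "(\<theta> has_real_derivative d3) (at t)" "(cc has_real_derivative d4) (at t)"
      "(xq has_real_derivative d5) (at t)" "(yq has_real_derivative d6) (at t)"
      "(\<phi> has_real_derivative d7) (at t)"
      unfolding d by (simp_all add: X has_vector_derivative_Pair_iff has_real_derivative_iff_has_vector_derivative)
    moreover have "slider_pusher \<alpha> \<beta> (X t) (vector_derivative X (at t)) (U t)"
      "X t \<in> sp_states \<mu>\<^sub>s \<mu>\<^sub>p" "U t \<in> sp_inputs \<sigma>\<^sub>n \<sigma>\<^sub>p"
      using assms(1) t by (auto simp: trajectory_def)
    then have "d1 = - v t * sin (\<theta> t)" "d2 = v t * cos (\<theta> t)"
      "d3 = cc t / (\<beta>\<^sup>2 + (cc t)\<^sup>2) * un t" "d4 = ut t - \<alpha> * (cc t / (\<beta>\<^sup>2 + (cc t)\<^sup>2)) * un t"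
      "xq t = x t + cc t * cos (\<theta> t) + \<alpha> * sin (\<theta> t)"
      "yq t = y t + cc t * sin (\<theta> t) - \<alpha> * cos (\<theta> t)"
      "d5 = - up t * sin (\<phi> t)" "d6 = up t * cos (\<phi> t)" "d7 = u\<omega> t"
      "\<bar>\<theta> t - \<mu>\<^sub>s\<bar> < pi" "\<bar>\<phi> t - \<mu>\<^sub>p\<bar> < pi" "\<sigma>\<^sub>n * un t > 0" "\<sigma>\<^sub>p * up t > 0"
      unfolding d by (simp_all add: X U v_def sp_states_def sp_inputs_def)
    ultimately show
    "(x has_real_derivative - v t * sin (\<theta> t)) (at t)" "(y has_real_derivative v t * cos (\<theta> t)) (at t)"
    "(\<theta> has_real_derivative cc t / (\<beta>\<^sup>2 + (cc t)\<^sup>2) * un t) (at t)"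
    "(cc has_real_derivative ut t - \<alpha> * (cc t / (\<beta>\<^sup>2 + (cc t)\<^sup>2)) * un t) (at t)"
    "xq t = x t + cc t * cos (\<theta> t) + \<alpha> * sin (\<theta> t)"
    "yq t = y t + cc t * sin (\<theta> t) - \<alpha> * cos (\<theta> t)"
    "(xq has_real_derivative - up t * sin (\<phi> t)) (at t)" "(yq has_real_derivative up t * cos (\<phi> t)) (at t)"
    "(\<phi> has_real_derivative u\<omega> t) (at t)"
    "\<bar>\<theta> t - \<mu>\<^sub>s\<bar> < pi" "\<bar>\<phi> t - \<mu>\<^sub>p\<bar> < pi" "\<sigma>\<^sub>n * un t > 0" "\<sigma>\<^sub>p * up t > 0"
      by simp_all
  qed
  \<comment> \<open>This carries an identity on \<open>I\<close> to the derivatives: from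
    \<open>\<theta>s\<close> to \<open>\<theta>s'\<close>, from \<open>c\<close> to
    \<open>c'\<close>, from \<open>\<theta>p\<close> to \<open>\<theta>p'\<close>.\<close>
  have unique: "f' = g'" if "t \<in> I" "\<And>t. t \<in> I \<Longrightarrow> f t = g t"
    "(f has_real_derivative f') (at t)" "(g has_real_derivative g') (at t)" for f g f' g' t
    using DERIV_unique[OF has_field_derivative_transform_within_open[OF that(3) I that(1,2)] that(4)] by blast
  have jet1: "jet \<zeta> t 1 = (- v t * sin (\<theta> t), v t * cos (\<theta> t))" if "t \<in> I" for t
    using jet_1[of \<zeta> "(- v t * sin (\<theta> t), v t * cos (\<theta> t))" t] eqs(1,2)[OF that]
    by (simp add: \<zeta>_def has_vector_derivative_Pair_iff has_real_derivative_iff_has_vector_derivative)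
  have v: "\<sigma>\<^sub>n * v t > 0" if "t \<in> I" for t
    using eqs(12)[OF that] pos[of t] \<beta> \<sigma>\<^sub>n by (auto simp: v_def zero_less_divide_iff zero_less_mult_iff mult_less_0_iff)
  have s: "jet \<zeta> t \<in> dom_s" "\<theta>s (jet \<zeta> t) = \<theta> t" "w (jet \<zeta> t) = v t" if "t \<in> I" for t
    using heading_unique[OF \<sigma>\<^sub>n v[OF that] refl refl eqs(10)[OF that]] jet1[OF that]
    by (simp_all add: dom_s_def \<theta>s_def w_def)
  have \<theta>': "\<theta>s' (jet \<zeta> t) = cc t / (\<beta>\<^sup>2 + (cc t)\<^sup>2) * un t" if "t \<in> I" for t
    by (rule unique[OF that s(2) total_derivativeD[OF total_derivatives(1) \<zeta> that s(1)[OF that]] eqs(3)[OF that]])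
  have c: "c (jet \<zeta> t) = cc t" if "t \<in> I" for t
  proof -
    \<comment> \<open>The normal velocity cancels from the ratio of turning rate to speed, leaving
      \<open>cc t / \<beta>\<^sup>2\<close>.\<close>
    have "un t \<noteq> 0" using eqs(12)[OF that] by auto
    then show ?thesis using pos[of t] \<beta> by (simp add: c_def \<theta>'[OF that] s(3)[OF that] v_def)
  qed
  have c': "c' (jet \<zeta> t) = ut t - \<alpha> * (cc t / (\<beta>\<^sup>2 + (cc t)\<^sup>2)) * un t" if "t \<in> I" for t
    by (rule unique[OF that c total_derivativeD[OF total_derivatives(2) \<zeta> that s(1)[OF that]] eqs(4)[OF that]])
  have vt: "vt (jet \<zeta> t) = ut t" if "t \<in> I" for t
    by (simp add: vt_def c'[OF that] \<theta>'[OF that])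
  have vn: "vn (jet \<zeta> t) = un t" if "t \<in> I" for t
    using pos[of t] \<beta> by (simp add: vn_def s(3)[OF that] c[OF that] v_def)
  \<comment> \<open>The normal velocity at the contact is the speed of the slider plus its rotation
    with lever arm \<open>cc t\<close>.\<close>
  have split: "v t + cc t * (cc t / (\<beta>\<^sup>2 + (cc t)\<^sup>2) * un t) = un t" for t
  proof -
    have "v t + cc t * (cc t / (\<beta>\<^sup>2 + (cc t)\<^sup>2) * un t) = (\<beta>\<^sup>2 + (cc t)\<^sup>2) * un t / (\<beta>\<^sup>2 + (cc t)\<^sup>2)"
      by (simp add: v_def add_divide_distrib power2_eq_square algebra_simps)
    then show ?thesis using pos[of t] \<beta> by simp
  qed
  have P: "xp' (jet \<zeta> t) = - up t * sin (\<phi> t)" "yp' (jet \<zeta> t) = up t * cos (\<phi> t)" if t: "t \<in> I" for t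
  proof -
    \<comment> \<open>The contact constraint gives a second expression for the pusher velocity, to
      be compared with the one from the car kinematics.\<close>
    have "((\<lambda>t. x t + cc t * cos (\<theta> t) + \<alpha> * sin (\<theta> t)) has_real_derivative
        ut t * cos (\<theta> t) - (v t + cc t * (cc t / (\<beta>\<^sup>2 + (cc t)\<^sup>2) * un t)) * sin (\<theta> t)) (at t)"
      by (auto intro!: derivative_eq_intros eqs t simp: algebra_simps)
    from unique[OF t eqs(5) eqs(7)[OF t] this] split[of t]
    show "xp' (jet \<zeta> t) = - up t * sin (\<phi> t)"
      by (simp add: xp'_def vt vn s t dom_s)
    have "((\<lambda>t. y t + cc t * sin (\<theta> t) - \<alpha> * cos (\<theta> t)) has_real_derivative
        ut t * sin (\<theta> t) + (v t + cc t * (cc t / (\<beta>\<^sup>2 + (cc t)\<^sup>2) * un t)) * cos (\<theta> t)) (at t)"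
      by (auto intro!: derivative_eq_intros eqs t simp: algebra_simps)
    from unique[OF t eqs(6) eqs(8)[OF t] this] split[of t]
    show "yp' (jet \<zeta> t) = up t * cos (\<phi> t)"
      by (simp add: yp'_def vt vn s t dom_s)
  qed
  have p: "jet \<zeta> t \<in> dom_p" "\<theta>p (jet \<zeta> t) = \<phi> t" "vp (jet \<zeta> t) = up t" if "t \<in> I" for t
    using heading_unique[OF \<sigma>\<^sub>p eqs(13)[OF that] P[OF that] eqs(11)[OF that]] s(1)[OF that]
    by (simp_all add: dom_p_def \<theta>p_def vp_def)
  have \<phi>': "\<theta>p' (jet \<zeta> t) = u\<omega> t"
    by (rule unique[OF assms(2) p(2) total_derivativeD[OF total_derivatives(3) \<zeta> assms(2) p(1)[OF assms(2)]]
          eqs(9)[OF assms(2)]])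
  show ?thesis
    unfolding out using eqs(5,6) s p c vt vn \<phi>' assms(2)
    by (simp add: X U flat_state_def flat_input_def xp_def yp_def dom_s) (simp add: \<zeta>_def)
qed

text \<open>No differential equation has to be solved: each one is an identity between jet formulas
  or the defining property of a total derivative. The main check is that \<open>xp'\<close> and
  \<open>yp'\<close> are the derivatives of \<open>xp\<close> and \<open>yp\<close>.\<close>

lemma trajectory_of_flat:
  assumes I: "open I" "is_interval I" and \<zeta>: "smooth_curve_on I \<zeta>" and dom_\<zeta>: "\<And>t. t \<in> I \<Longrightarrow> jet \<zeta> t \<in> dom_p"
  shows "trajectory (slider_pusher \<alpha> \<beta>) (sp_states \<mu>\<^sub>s \<mu>\<^sub>p) (sp_inputs \<sigma>\<^sub>n \<sigma>\<^sub>p) I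
    (\<lambda>t. flat_state (jet \<zeta> t)) (\<lambda>t. flat_input (jet \<zeta> t))"
  unfolding trajectory_def
proof (intro conjI ballI I)
  have "smooth_curve_on I (\<lambda>t. F (jet \<zeta> t))" if "dfun dom_p m F" for m F
    by (rule smooth_curve_on_dfun[OF I(1) \<zeta> dom_\<zeta> that])
  note smooth = dfun_dom[THEN this]
  show "smooth_curve_on I (\<lambda>t. flat_state (jet \<zeta> t))" "smooth_curve_on I (\<lambda>t. flat_input (jet \<zeta> t))"
    unfolding flat_state_def flat_input_def
    by (intro smooth_curve_on_Pair I(1) smooth)+
  fix t assume t: "t \<in> I"
  have D: "jet \<zeta> t \<in> dom_p" "jet \<zeta> t \<in> dom_s" using dom_\<zeta>[OF t] dom_subset by auto
  have pos: "\<beta>\<^sup>2 + (c j)\<^sup>2 > 0" for j using \<beta> by (simp add: add_pos_nonneg)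
  have vn: "\<beta>\<^sup>2 / (\<beta>\<^sup>2 + (c j)\<^sup>2) * vn j = w j" for j
    using pos[of j] \<beta> by (simp add: vn_def)
  show "flat_state (jet \<zeta> t) \<in> sp_states \<mu>\<^sub>s \<mu>\<^sub>p"
    using dom_p[OF D(1)] dom_s[OF D(2)] by (simp add: flat_state_def sp_states_def)
  have "\<sigma>\<^sub>n * vn (jet \<zeta> t) > 0"
    using dom_s(1)[OF D(2)] pos \<beta> \<sigma>\<^sub>n by (auto simp: vn_def zero_less_divide_iff zero_less_mult_iff mult_less_0_iff)
  then show "flat_input (jet \<zeta> t) \<in> sp_inputs \<sigma>\<^sub>n \<sigma>\<^sub>p"
    using dom_p[OF D(1)] by (simp add: flat_input_def sp_inputs_def)
  have "((\<lambda>t. (fst (\<zeta> t), snd (\<zeta> t))) has_vector_derivative (fst (jet \<zeta> t 1), snd (jet \<zeta> t 1))) (at t)"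
    using smooth_curve_on_nth_vderiv[OF \<zeta> t, of 0] by (simp add: jet_def)
  then have d12: "((\<lambda>t. fst (\<zeta> t)) has_real_derivative fst (jet \<zeta> t 1)) (at t)"
    "((\<lambda>t. snd (\<zeta> t)) has_real_derivative snd (jet \<zeta> t 1)) (at t)"
    unfolding has_vector_derivative_Pair_iff has_real_derivative_iff_has_vector_derivative by simp_all
  have d3: "((\<lambda>t. \<theta>s (jet \<zeta> t)) has_real_derivative \<theta>s' (jet \<zeta> t)) (at t)"
    by (rule total_derivativeD[OF total_derivatives(1) \<zeta> t D(2)])
  have d4: "((\<lambda>t. c (jet \<zeta> t)) has_real_derivative c' (jet \<zeta> t)) (at t)"
    by (rule total_derivativeD[OF total_derivatives(2) \<zeta> t D(2)])
  have d7: "((\<lambda>t. \<theta>p (jet \<zeta> t)) has_real_derivative \<theta>p' (jet \<zeta> t)) (at t)"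
    by (rule total_derivativeD[OF total_derivatives(3) \<zeta> t D(1)])
  have \<theta>': "\<theta>s' j = c j / (\<beta>\<^sup>2 + (c j)\<^sup>2) * vn j" if "j \<in> dom_s" for j
    using pos[of j] \<beta> dom_s(5)[OF that] by (simp add: vn_def c_def)
  \<comment> \<open>By the definition of \<open>c\<close>, \<open>\<theta>s'\<close> is
    \<open>c * w / \<beta>\<^sup>2\<close>, so the left side is
    \<open>w * (\<beta>\<^sup>2 + c\<^sup>2) / \<beta>\<^sup>2\<close>.\<close>
  have wc: "w j + c j * \<theta>s' j = vn j" if "j \<in> dom_s" for j
  proof -
    have "w j * (\<beta>\<^sup>2 + (c j)\<^sup>2) = \<beta>\<^sup>2 * (w j + c j * \<theta>s' j)"
      using dom_s(5)[OF that] by (simp add: c_def field_simps power2_eq_square)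
    then show ?thesis using \<beta> by (simp add: vn_def)
  qed
  have in_dom_s: "jet \<zeta> t \<in> dom_s" if "t \<in> I" for t using dom_\<zeta>[OF that] dom_subset by auto
  \<comment> \<open>The derivative is taken with the true cosine and sine of
    \<open>\<theta>s\<close>, then transferred to \<open>xp\<close>, whose quotients agree with them
    on \<open>dom_s\<close>. The index 1 is unfolded to match the \<open>Suc 0\<close> that
    simplification produces.\<close>
  have "((\<lambda>t. fst (\<zeta> t) + c (jet \<zeta> t) * cos (\<theta>s (jet \<zeta> t)) + \<alpha> * sin (\<theta>s (jet \<zeta> t))) has_real_derivative
      xp' (jet \<zeta> t)) (at t)"
    by (auto intro!: derivative_eq_intros d12 d3 d4 simp: xp'_def vt_def dom_s[OF D(2), unfolded One_nat_def] algebra_simps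
        simp flip: wc[OF D(2)])
  then have d5: "((\<lambda>t. xp (jet \<zeta> t)) has_real_derivative xp' (jet \<zeta> t)) (at t)"
    by (rule has_field_derivative_transform_within_open[OF _ I(1) t])
      (simp add: xp_def dom_s in_dom_s)
  have "((\<lambda>t. snd (\<zeta> t) + c (jet \<zeta> t) * sin (\<theta>s (jet \<zeta> t)) - \<alpha> * cos (\<theta>s (jet \<zeta> t))) has_real_derivative
      yp' (jet \<zeta> t)) (at t)"
    by (auto intro!: derivative_eq_intros d12 d3 d4 simp: yp'_def vt_def dom_s[OF D(2), unfolded One_nat_def] algebra_simps
        simp flip: wc[OF D(2)])
  then have d6: "((\<lambda>t. yp (jet \<zeta> t)) has_real_derivative yp' (jet \<zeta> t)) (at t)"
    by (rule has_field_derivative_transform_within_open[OF _ I(1) t])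
      (simp add: yp_def dom_s in_dom_s)
  have "((\<lambda>t. flat_state (jet \<zeta> t)) has_vector_derivative
      (fst (jet \<zeta> t 1), snd (jet \<zeta> t 1), \<theta>s' (jet \<zeta> t), c' (jet \<zeta> t), xp' (jet \<zeta> t), yp' (jet \<zeta> t), \<theta>p' (jet \<zeta> t))) (at t)"
    unfolding flat_state_def jet_0
    by (intro has_vector_derivative_Pair d12 d3 d4 d5 d6 d7 has_real_derivative_iff_has_vector_derivative[THEN iffD1])
  then have "vector_derivative (\<lambda>t. flat_state (jet \<zeta> t)) (at t) =
      (fst (jet \<zeta> t 1), snd (jet \<zeta> t 1), \<theta>s' (jet \<zeta> t), c' (jet \<zeta> t), xp' (jet \<zeta> t), yp' (jet \<zeta> t), \<theta>p' (jet \<zeta> t))"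
    by (rule vector_derivative_at)
  moreover have "fst (jet \<zeta> t 1) = - (\<beta>\<^sup>2 / (\<beta>\<^sup>2 + (c (jet \<zeta> t))\<^sup>2)) * vn (jet \<zeta> t) * sin (\<theta>s (jet \<zeta> t))"
    using dom_s(2)[OF D(2)] vn[of "jet \<zeta> t"] by simp
  moreover have "snd (jet \<zeta> t 1) = \<beta>\<^sup>2 / (\<beta>\<^sup>2 + (c (jet \<zeta> t))\<^sup>2) * vn (jet \<zeta> t) * cos (\<theta>s (jet \<zeta> t))"
    using dom_s(3)[OF D(2)] vn[of "jet \<zeta> t"] by simp
  moreover have "c' (jet \<zeta> t) = vt (jet \<zeta> t) - \<alpha> * (c (jet \<zeta> t) / (\<beta>\<^sup>2 + (c (jet \<zeta> t))\<^sup>2)) * vn (jet \<zeta> t)"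
    by (simp add: vt_def \<theta>'[OF D(2)])
  ultimately show "slider_pusher \<alpha> \<beta> (flat_state (jet \<zeta> t))
      (vector_derivative (\<lambda>t. flat_state (jet \<zeta> t)) (at t)) (flat_input (jet \<zeta> t))"
    using \<theta>'[OF D(2)] dom_p[OF D(1)] dom_s(6,7)[OF D(2)]
    by (simp add: flat_state_def flat_input_def xp_def yp_def)
qed

text \<open>Shows that output jets exist. With contact at the axis, \<open>c = 0\<close>, the slider
  does not turn, and both bodies translate at speed 1.\<close>

lemma straight_trajectory:
  obtains X U where "trajectory (slider_pusher \<alpha> \<beta>) (sp_states \<mu>\<^sub>s \<mu>\<^sub>p) (sp_inputs \<sigma>\<^sub>n \<sigma>\<^sub>p) UNIV X U"
proof -
  obtain \<theta> \<theta>' where \<theta>: "\<bar>\<theta> - \<mu>\<^sub>s\<bar> < pi" "\<bar>\<theta>' - \<mu>\<^sub>p\<bar> < pi"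
    "\<sigma>\<^sub>n * sin \<theta> = \<sigma>\<^sub>p * sin \<theta>'" "\<sigma>\<^sub>n * cos \<theta> = \<sigma>\<^sub>p * cos \<theta>'"
    using heading_compatible[OF \<sigma>\<^sub>n \<sigma>\<^sub>p] by blast
  define A :: sp_state where "A = (0, 0, \<theta>, 0, \<alpha> * sin \<theta>, - \<alpha> * cos \<theta>, \<theta>')"
  define B :: sp_state where
    "B = (- \<sigma>\<^sub>n * sin \<theta>, \<sigma>\<^sub>n * cos \<theta>, 0, 0, - \<sigma>\<^sub>n * sin \<theta>, \<sigma>\<^sub>n * cos \<theta>, 0)"
  define U :: sp_input where "U = (0, \<sigma>\<^sub>n, \<sigma>\<^sub>p, 0)"
  have "vector_derivative (\<lambda>t. A + t *\<^sub>R B) (at t) = B" for t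
    by (rule vector_derivative_at) (auto intro!: derivative_eq_intros)
  moreover have "smooth_curve_on UNIV (\<lambda>t. U)"
    using smooth_curve_on_affine[of U 0] by simp
  ultimately have "trajectory (slider_pusher \<alpha> \<beta>) (sp_states \<mu>\<^sub>s \<mu>\<^sub>p) (sp_inputs \<sigma>\<^sub>n \<sigma>\<^sub>p) UNIV
      (\<lambda>t. A + t *\<^sub>R B) (\<lambda>t. U)"
    using \<theta> \<beta> \<sigma>\<^sub>n \<sigma>\<^sub>p smooth_curve_on_affine[of A B] unfolding trajectory_def
    by (auto simp: A_def B_def U_def sp_states_def sp_inputs_def is_interval_univ)
  then show ?thesis by (rule that)
qed

lemma flat: "differentially_flat (slider_pusher \<alpha> \<beta>) (sp_states \<mu>\<^sub>s \<mu>\<^sub>p) (sp_inputs \<sigma>\<^sub>n \<sigma>\<^sub>p) position_output"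
proof -
  obtain X U where XU: "trajectory (slider_pusher \<alpha> \<beta>) (sp_states \<mu>\<^sub>s \<mu>\<^sub>p) (sp_inputs \<sigma>\<^sub>n \<sigma>\<^sub>p) UNIV X U"
    by (rule straight_trajectory)
  have position_output: "position_output x = (\<lambda>_. (fst x, fst (snd x)))" for x
    by (simp add: case_prod_unfold)
  have "dfun UNIV 0 (\<lambda>j :: nat \<Rightarrow> sp_state \<times> sp_input. fst (fst (j 0)))"
    "dfun UNIV 0 (\<lambda>j :: nat \<Rightarrow> sp_state \<times> sp_input. fst (snd (fst (j 0))))"
    using dfun_fst[of 0 0 UNIV "(1, 0) :: sp_state"] dfun_fst[of 0 0 UNIV "(0, 1, 0) :: sp_state"]
    by (simp_all add: inner_prod_def)
  then have smooth: "jet_smooth_on UNIV (\<lambda>j. position_output (fst (j 0)) (\<lambda>k. snd (j k)))"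
    unfolding position_output by (intro jet_smooth_on_Pair dfun_smooth[OF _ open_UNIV])
  have order: "jet_order_le 0 (position_output x)" for x
    by (simp add: position_output jet_order_le_def)
  have bwd: "\<exists>x u. trajectory (slider_pusher \<alpha> \<beta>) (sp_states \<mu>\<^sub>s \<mu>\<^sub>p) (sp_inputs \<sigma>\<^sub>n \<sigma>\<^sub>p) I x u \<and>
      output_curve position_output x u = \<zeta>"
    if "open I" "is_interval I" "smooth_curve_on I \<zeta>" "\<And>t. t \<in> I \<Longrightarrow> jet \<zeta> t \<in> dom_p" for I \<zeta>
    \<comment> \<open>\<open>flat_state\<close> copies the entry \<open>j 0\<close>, so the output
      is \<open>\<zeta>\<close> at all times, also outside \<open>I\<close>.\<close>
    using trajectory_of_flat[OF that] by (intro exI conjI) (auto simp: output_curve_def flat_state_def)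
  show ?thesis
    by (rule differentially_flatI[OF smooth order smooth_flat_state smooth_flat_input order_flat_state
          order_flat_input flat_of_trajectory bwd XU UNIV_not_empty])
qed

end

theorem theorem1:
  fixes a b \<beta> r \<alpha> :: real and \<mu>\<^sub>s \<mu>\<^sub>p \<sigma>\<^sub>n \<sigma>\<^sub>p :: real
  assumes "a > 0" and "b > 0" and "\<beta> > 0" and "r \<ge> 0" and "\<alpha> = b / 2 + r"
    and "\<sigma>\<^sub>n \<in> {1, -1}" and "\<sigma>\<^sub>p \<in> {1, -1}"
  shows "differentially_flat (slider_pusher \<alpha> \<beta>) (sp_states \<mu>\<^sub>s \<mu>\<^sub>p) (sp_inputs \<sigma>\<^sub>n \<sigma>\<^sub>p)
           (\<lambda>(x\<^sub>s, y\<^sub>s, \<theta>\<^sub>s, c, x\<^sub>p, y\<^sub>p, \<theta>\<^sub>p) _. (x\<^sub>s, y\<^sub>s))"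
  by (rule slider_pusher_branch.flat) (use assms in \<open>simp add: slider_pusher_branch_def\<close>)

end
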